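(* Let $\varepsilon>0$ and let $\lambda:[0,\infty)\to[0,\infty)$ be a BS density function. Consider a Poisson point process on $[0,\infty)$ with intensity $\lambda$, with points $R_1,R_2,\dots$ (distances of base stations from a mobile station at the origin), and attach to each point $i$ a pair $(\Psi_i,K_i)$ of positive random variables (shadow fading factor and transmission power), the pairs being i.i.d. across base stations and independent of the point process ($\Psi_i$ and $K_i$ may be dependent). Let $(\Psi,K)$ have the common distribution of the pairs. Let $j$ be the index maximizing the received power $K_i\Psi_iR_i^{-\varepsilon}$ and $$\frac CI=\frac{K_j\Psi_jR_j^{-\varepsilon}}{\sum_{i\ne j}K_i\Psi_iR_i^{-\varepsilon}}.$$ Define $\bar\lambda(r)=\mathbb E_{\Psi,K}\!\left[(\Psi K)^{1/\varepsilon}\lambda\!\left(r(\Psi K)^{1/\varepsilon}\right)\right]$ and suppose this expectation converges. Then $\frac CI$ has the same distribution as $\frac{\bar R_1^{-\varepsilon}}{\sum_{i\ge2}\bar R_i^{-\varepsilon}}$, where $\bar R_1\le\bar R_2\le\cdots$ are the ordered points of a Poisson point process on $[0,\infty)$ with intensity $\bar\lambda$ (i.e. a 1-D SCS with BS density $\bar\lambda$ and unit shadow fading and transmission powers).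
   Context: A 1-D shotgun cellular system (SCS) with BS density function $\lambda(r)$ is a Poisson point process on $[0,\infty)$ with intensity $\lambda$ whose points are distances of base stations from a mobile station at the origin; path loss is $R^{-\varepsilon}$; the mobile is served by the BS with strongest received power and all other BSs interfere.
   Formalization: The point processes are taken to have infinitely many points, so the density λ has infinite total mass; for finite total mass there is with positive probability no base station, and then the index j, C/I and R̄_1 are undefined. *)

theory Defs
  imports "HOL-Probability.Probability"
begin

definition poisson_count :: "'a measure \<Rightarrow> ('a \<Rightarrow> ennreal) \<Rightarrow> ennreal \<Rightarrow> bool" where
  "poisson_count M N mu \<longleftrightarrow> N \<in> borel_measurable M \<and>
     (if mu = \<top> then (AE \<omega> in M. N \<omega> = \<top>)
      else (\<forall>n::nat. measure M {\<omega> \<in> space M. N \<omega> = of_nat n}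
                     = exp (- enn2real mu) * enn2real mu ^ n / fact n))"

definition count_pts :: "(nat \<Rightarrow> 'a \<Rightarrow> real) \<Rightarrow> real set \<Rightarrow> 'a \<Rightarrow> ennreal" where
  "count_pts R A \<omega> = (\<Sum>i. indicator A (R i \<omega>))"

definition PPP :: "'a measure \<Rightarrow> (nat \<Rightarrow> 'a \<Rightarrow> real) \<Rightarrow> (real \<Rightarrow> real) \<Rightarrow> bool" where
  "PPP M R lam \<longleftrightarrow> prob_space M \<and> (\<forall>i. R i \<in> borel_measurable M) \<and>
     (\<forall>A \<in> sets borel. poisson_count M (count_pts R A)
         (\<integral>\<^sup>+ r. indicator (A \<inter> {0..}) r * ennreal (lam r) \<partial>lborel)) \<and>
     (\<forall>(I::nat set) (A::nat \<Rightarrow> real set). finite I \<longrightarrow> (\<forall>i\<in>I. A i \<in> sets borel) \<longrightarrow>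
         disjoint_family_on A I \<longrightarrow>
         prob_space.indep_vars M (\<lambda>_. borel) (\<lambda>i. count_pts R (A i)) I)"

text \<open>The averaged BS density  E[(Psi K)^(1/eps) lam (r (Psi K)^(1/eps))],
  D being the common law of (Psi, K).\<close>
definition lambar :: "real \<Rightarrow> (real \<times> real) measure \<Rightarrow> (real \<Rightarrow> real) \<Rightarrow> real \<Rightarrow> real" where
  "lambar eps D lam r = (\<integral>x. (fst x * snd x) powr (1/eps) * lam (r * (fst x * snd x) powr (1/eps)) \<partial>D)"

definition CI_ratio :: "(nat \<Rightarrow> ennreal) \<Rightarrow> ennreal" where
  "CI_ratio P = (let j = (SOME j. \<forall>i. P i \<le> P j) in P j / (\<Sum>i. if i = j then 0 else P i))"

end

theory Submission
  imports Defs
begin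

text \<open>
  The Laplace functional \<open>E exp (- (\<Sum>i. h (X i)))\<close> of a Poisson process, with test functions \<open>h\<close> valued in
  \<open>[0, \<infinity>]\<close>, depends only on the intensity and behaves well under independent marking and mapping.
  Marking the points \<open>R i\<close> by \<open>(Psi i, K i)\<close> and mapping to the received powers \<open>K i \<cdot> Psi i \<cdot> R i powr - eps\<close>
  gives, by the substitution \<open>r = s (\<psi> k) powr (1/eps)\<close>, the same intensity as mapping the process with intensity
  \<open>lambar\<close> by \<open>r \<mapsto> r powr - eps\<close>.

  The ratio is \<open>S / (Z - S)\<close> with \<open>S\<close> the supremum and \<open>Z\<close> the sum of the powers, and the choice
  \<open>h x = n x + \<infinity> \<cdot> [x > t]\<close> reads off \<open>E [S \<le> t] exp (- Z) ^ n\<close>. These are moments of a random variable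
  in \<open>[0, 1]\<close>, so by Weierstrass approximation they determine the joint law of \<open>(S, Z)\<close>. The intensity need not be
  locally finite; that the supremum is attained is deduced from the second process being sorted.
\<close>

section \<open>The function \<open>exp (- x)\<close> on the extended nonnegative reals\<close>

text \<open>The value 0 at infinity keeps the exponential multiplicative and continuous on all of
  [0, \<infinity>], so divergent sums and infinite intensities obey the same formulas as finite
  ones. Values in \<open>ennreal\<close> make every expectation an
  \<open>nn_integral\<close>.\<close>

definition exp_neg :: "ennreal \<Rightarrow> ennreal" where
  "exp_neg x = (if x = \<top> then 0 else ennreal (exp (- enn2real x)))"

lemma exp_neg_top [simp]: "exp_neg \<top> = 0"
  by (simp add: exp_neg_def)

lemma exp_neg_0 [simp]: "exp_neg 0 = 1"
  by (simp add: exp_neg_def)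

lemma exp_neg_ennreal: "0 \<le> x \<Longrightarrow> exp_neg (ennreal x) = ennreal (exp (- x))"
  by (simp add: exp_neg_def)

lemma exp_neg_eq_0_iff [simp]: "exp_neg x = 0 \<longleftrightarrow> x = \<top>"
  by (simp add: exp_neg_def)

lemma exp_neg_le_1 [simp]: "exp_neg x \<le> 1"
  by (simp add: exp_neg_def)

lemma exp_neg_less_top [simp]: "exp_neg x < \<top>"
  by (simp add: exp_neg_def)

lemma exp_neg_neq_top [simp]: "exp_neg x \<noteq> \<top>"
  by (simp add: exp_neg_def)

lemma exp_neg_eq_1_iff [simp]: "exp_neg x = 1 \<longleftrightarrow> x = 0"
  by (cases x) (auto simp: exp_neg_ennreal simp flip: ennreal_1)

lemma exp_neg_add: "exp_neg (x + y) = exp_neg x * exp_neg y"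
  by (cases x; cases y)
     (auto simp: exp_neg_ennreal simp flip: ennreal_plus ennreal_mult exp_add)

lemma exp_neg_sum: "exp_neg (\<Sum>i\<in>I. f i) = (\<Prod>i\<in>I. exp_neg (f i))"
  by (induction I rule: infinite_finite_induct) (auto simp: exp_neg_add)

lemma exp_neg_mult_of_nat: "exp_neg (of_nat n * x) = exp_neg x ^ n"
  by (induction n) (auto simp: exp_neg_add distrib_right)

lemma exp_neg_antimono: "x \<le> y \<Longrightarrow> exp_neg y \<le> exp_neg x"
  by (cases x; cases y) (auto simp: exp_neg_ennreal top_unique)

lemma measurable_exp_neg [measurable]: "exp_neg \<in> borel_measurable borel"
  unfolding exp_neg_def by measurable

text \<open>The delicate case is the limit infinity: a tolerance e is met once \<open>f n\<close>
  exceeds \<open>- ln e\<close>, and e < 1 keeps this threshold from being truncated at 0.\<close>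

lemma tendsto_exp_neg:
  assumes "f \<longlonglongrightarrow> x"
  shows "(\<lambda>n. exp_neg (f n)) \<longlonglongrightarrow> exp_neg x"
proof (cases x)
  case (real r)
  have "eventually (\<lambda>n. f n < \<top>) sequentially"
    using assms real by (intro order_tendstoD) auto
  moreover have "(\<lambda>n. ennreal (exp (- enn2real (f n)))) \<longlonglongrightarrow> ennreal (exp (- r))"
    using assms real by (intro tendsto_intros tendsto_enn2real) auto
  ultimately have "(\<lambda>n. exp_neg (f n)) \<longlonglongrightarrow> ennreal (exp (- r))"
    by (elim Lim_transform_eventually eventually_mono) (auto simp: exp_neg_def)
  then show ?thesis using real by (simp add: exp_neg_ennreal)
next
  case top
  show ?thesis unfolding top exp_neg_top
  proof (rule order_tendstoI)
    fix a :: ennreal assume "0 < a"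
    then have "0 < min a 1" by simp
    then obtain b where b: "0 < b" "b < min a 1" using dense by blast
    then obtain e where e: "0 < e" "ennreal e < a" "e < 1"
      by (cases b) (auto simp: ennreal_less_iff simp flip: ennreal_1)
    have "eventually (\<lambda>n. ennreal (- ln e) < f n) sequentially"
      using assms top by (intro order_tendstoD) auto
    then show "eventually (\<lambda>n. exp_neg (f n) < a) sequentially"
    proof eventually_elim
      case (elim n)
      then have "exp_neg (f n) \<le> exp_neg (ennreal (- ln e))"
        by (intro exp_neg_antimono) auto
      also have "\<dots> = ennreal e" using e by (simp add: exp_neg_ennreal)
      finally show ?case using e by simp
    qed
  qed auto
qed

text \<open>Inverse of \<open>exp_neg\<close>, from [0, 1] back to [0, \<infinity>]. It turns the
  mean exponential over a mark into a test function again, and later recovers the sum of the powers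
  from its exponential. The value at 0 is set apart because \<open>ln 0 = 0\<close> in HOL.\<close>

definition log_neg :: "ennreal \<Rightarrow> ennreal" where
  "log_neg v = (if v = 0 then \<top> else ennreal (- ln (enn2real v)))"

lemma exp_neg_log_neg: "v \<le> 1 \<Longrightarrow> exp_neg (log_neg v) = v"
  by (cases v) (auto simp: log_neg_def exp_neg_ennreal ennreal_eq_0_iff not_le top_unique)

lemma log_neg_exp_neg: "log_neg (exp_neg x) = x"
  by (cases x) (auto simp: log_neg_def exp_neg_ennreal)

lemma measurable_log_neg [measurable]: "log_neg \<in> borel_measurable borel"
  unfolding log_neg_def by measurable

section \<open>Laplace functionals of Poisson processes\<close>

text \<open>\<open>poisson_count\<close> prescribes the masses at the natural numbers. By the
  exponential series they add up to 1, which leaves nothing for infinity or for non-integral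
  values.\<close>

lemma (in prob_space) poisson_count_AE_nat:
  assumes "poisson_count M N \<mu>" "\<mu> \<noteq> \<top>"
  shows "AE \<omega> in M. \<exists>n::nat. N \<omega> = of_nat n"
proof -
  have [measurable]: "N \<in> borel_measurable M"
    using assms by (simp add: poisson_count_def)
  define A where "A n = {\<omega> \<in> space M. N \<omega> = of_nat n}" for n :: nat
  have A[measurable]: "A n \<in> sets M" for n
    unfolding A_def by measurable
  have disj: "disjoint_family A"
    by (auto simp: disjoint_family_on_def A_def)
  have "(\<lambda>n. prob (A n)) sums prob (\<Union>n. A n)"
    using disj by (intro finite_measure_UNION) auto
  moreover have "(\<lambda>n. prob (A n)) sums 1"
  proof -
    have "(\<lambda>n. exp (- enn2real \<mu>) * (enn2real \<mu> ^ n /\<^sub>R fact n))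
        sums (exp (- enn2real \<mu>) * exp (enn2real \<mu>))"
      by (intro sums_mult exp_converges)
    then show ?thesis
      using assms by (simp add: poisson_count_def A_def exp_minus divide_inverse mult.commute
          mult.left_commute)
  qed
  ultimately have "prob (\<Union>n. A n) = 1"
    by (rule sums_unique2)
  then have "AE \<omega> in M. \<omega> \<in> (\<Union>n. A n)"
    by (intro AE_prob_1)
  then show ?thesis
    by eventually_elim (auto simp: A_def)
qed

text \<open>For a finite mean this is the Poisson generating function at \<open>exp_neg y\<close>.
  For an infinite mean the count is almost surely infinite, and both sides are 0 unless y = 0, where
  0 * \<infinity> = 0 makes both 1.\<close>

lemma (in prob_space) poisson_count_laplace:
  assumes N: "poisson_count M N \<mu>"
  shows "(\<integral>\<^sup>+\<omega>. exp_neg (y * N \<omega>) \<partial>M) = exp_neg ((1 - exp_neg y) * \<mu>)"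
proof (cases "\<mu> = \<top>")
  case True
  then have "AE \<omega> in M. N \<omega> = \<top>" using N by (simp add: poisson_count_def)
  then have "(\<integral>\<^sup>+\<omega>. exp_neg (y * N \<omega>) \<partial>M) = (\<integral>\<^sup>+\<omega>. exp_neg (y * \<top>) \<partial>M)"
    by (intro nn_integral_cong_AE) (auto elim: eventually_mono)
  also have "\<dots> = exp_neg (y * \<top>)" by (simp add: emeasure_space_1)
  also have "\<dots> = exp_neg ((1 - exp_neg y) * \<mu>)"
  proof (cases "y = 0")
    case False
    then have "exp_neg y < 1" using exp_neg_le_1[of y] by (auto simp: less_le)
    then show ?thesis using True False
      by (auto simp: ennreal_mult_eq_top_iff ennreal_mult_top ennreal_top_mult diff_eq_0_iff_ennreal)
  qed simp
  finally show ?thesis .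
next
  case False
  then obtain m where m: "\<mu> = ennreal m" "0 \<le> m" by (cases \<mu>) auto
  have [measurable]: "N \<in> borel_measurable M"
    using N by (simp add: poisson_count_def)
  define A where "A n = {\<omega> \<in> space M. N \<omega> = of_nat n}" for n :: nat
  have A[measurable]: "A n \<in> sets M" for n
    unfolding A_def by measurable
  obtain e where e: "exp_neg y = ennreal e" "0 \<le> e" "e \<le> 1"
    using exp_neg_le_1[of y] by (cases "exp_neg y") (auto simp flip: ennreal_1 simp: ennreal_le_iff2)
  \<comment> \<open>Almost surely exactly one of the events \<open>A n\<close> occurs, so the series
    has a single term that can be nonzero.\<close>
  have "(\<integral>\<^sup>+\<omega>. exp_neg (y * N \<omega>) \<partial>M) = (\<integral>\<^sup>+\<omega>. (\<Sum>n. exp_neg y ^ n * indicator (A n) \<omega>) \<partial>M)"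
  proof (rule nn_integral_cong_AE)
    show "AE \<omega> in M. exp_neg (y * N \<omega>) = (\<Sum>n. exp_neg y ^ n * indicator (A n) \<omega>)"
      using poisson_count_AE_nat[OF N False] AE_space
    proof eventually_elim
      case (elim \<omega>)
      then obtain n :: nat where n: "N \<omega> = of_nat n" by auto
      have "(\<Sum>k. exp_neg y ^ k * indicator (A k) \<omega>) = (\<Sum>k\<in>{n}. exp_neg y ^ k * indicator (A k) \<omega>)"
        by (rule suminf_finite) (auto simp: A_def n)
      then show ?case
        using elim n by (simp add: A_def exp_neg_mult_of_nat[symmetric] mult.commute)
    qed
  qed
  also have "\<dots> = (\<Sum>n. exp_neg y ^ n * emeasure M (A n))"
    by (subst nn_integral_suminf) (auto simp: nn_integral_cmult)
  also have "\<dots> = (\<Sum>n. ennreal (e ^ n * (exp (- m) * m ^ n / fact n)))"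
  proof -
    have "prob (A n) = exp (- m) * m ^ n / fact n" for n
      using N m False by (auto simp: A_def poisson_count_def)
    then show ?thesis
      using e m by (simp add: emeasure_eq_measure ennreal_power ennreal_mult'[symmetric])
  qed
  also have "\<dots> = ennreal (exp (- m) * exp (e * m))"
  proof (rule suminf_ennreal_eq)
    have "(\<lambda>n. exp (- m) * ((e * m) ^ n /\<^sub>R fact n)) sums (exp (- m) * exp (e * m))"
      by (intro sums_mult exp_converges)
    then show "(\<lambda>n. e ^ n * (exp (- m) * m ^ n / fact n)) sums (exp (- m) * exp (e * m))"
      by (simp add: power_mult_distrib divide_inverse ac_simps)
  qed (use m e in auto)
  also have "\<dots> = exp_neg ((1 - exp_neg y) * \<mu>)"
  proof -
    have "(1 - exp_neg y) * \<mu> = ennreal ((1 - e) * m)"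
      using e m by (simp add: ennreal_mult ennreal_minus flip: ennreal_1)
    then show ?thesis
      using e m by (simp add: exp_neg_ennreal flip: exp_add) (simp add: algebra_simps)
  qed
  finally show ?thesis .
qed

text \<open>\<open>PPP\<close> speaks of counts on disjoint sets of reals, which is awkward under
  marking and mapping. This form allows points in any measurable space and survives both operations;
  the value infinity of \<open>h\<close> also encodes that a set contains no point.\<close>

definition poisson_laplace :: "'a measure \<Rightarrow> (nat \<Rightarrow> 'a \<Rightarrow> 'b) \<Rightarrow> 'b measure \<Rightarrow> bool" where
  "poisson_laplace M X \<nu> \<longleftrightarrow> prob_space M \<and> (\<forall>i. X i \<in> measurable M \<nu>) \<and>
     (\<forall>h\<in>borel_measurable \<nu>. (\<integral>\<^sup>+\<omega>. exp_neg (\<Sum>i. h (X i \<omega>)) \<partial>M)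
        = exp_neg (\<integral>\<^sup>+x. (1 - exp_neg (h x)) \<partial>\<nu>))"

lemma poisson_laplaceD:
  assumes "poisson_laplace M X \<nu>" "h \<in> borel_measurable \<nu>"
  shows "(\<integral>\<^sup>+\<omega>. exp_neg (\<Sum>i. h (X i \<omega>)) \<partial>M) = exp_neg (\<integral>\<^sup>+x. (1 - exp_neg (h x)) \<partial>\<nu>)"
  using assms by (simp add: poisson_laplace_def)

text \<open>The level sets of \<open>h\<close> are disjoint, so the sum over the points is a finite
  combination of independent Poisson counts, and the expectation factors into their
  transforms.\<close>

lemma PPP_laplace_simple:
  fixes lam
  defines "\<nu> \<equiv> density lborel (\<lambda>r. indicator {0..} r * ennreal (lam r))"
  assumes ppp: "PPP M R lam" and lam[measurable]: "lam \<in> borel_measurable borel"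
    and h: "simple_function borel h"
  shows "(\<integral>\<^sup>+\<omega>. exp_neg (\<Sum>i. h (R i \<omega>)) \<partial>M) = exp_neg (\<integral>\<^sup>+x. (1 - exp_neg (h x)) \<partial>\<nu>)"
proof -
  interpret prob_space M using ppp by (simp add: PPP_def)
  have h_meas[measurable]: "h \<in> borel_measurable borel"
    using h by (rule borel_measurable_simple_function)
  have fin: "finite (range h)" using h by (simp add: simple_function_def)
  \<comment> \<open>The finitely many values are numbered because \<open>PPP\<close> states
    independence for families indexed by natural numbers.\<close>
  then obtain n :: nat and g where g: "range h = g ` {i. i < n}" "inj_on g {i. i < n}"
    using finite_imp_nat_seg_image_inj_on[OF fin] by metis
  define I where "I = {i. i < n}"
  have I: "finite I" "range h = g ` I" "inj_on g I" using g by (auto simp: I_def)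
  define A where "A k = h -` {g k}" for k
  have A[measurable]: "A k \<in> sets borel" for k
    using measurable_sets[OF h_meas, of "{g k}"] by (simp add: A_def)
  have disj: "disjoint_family_on A I"
    using I by (auto simp: disjoint_family_on_def A_def inj_on_def)
  \<comment> \<open>Two choices of \<open>F\<close> are used: the identity, for the sum over the
    points, and \<open>1 - exp_neg y\<close>, for the intensity integral.\<close>
  have rep: "F (h x) = (\<Sum>k\<in>I. F (g k) * indicator (A k) x)" for x and F :: "ennreal \<Rightarrow> ennreal"
  proof -
    obtain k where k: "k \<in> I" "h x = g k" using I by (metis UNIV_I image_iff)
    have "(\<Sum>j\<in>I. F (g j) * indicator (A j) x) = (\<Sum>j\<in>I. if j = k then F (g k) else 0)"
      using k I by (intro sum.cong) (auto simp: A_def inj_on_def split: split_indicator)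
    also have "\<dots> = F (h x)" using k I by simp
    finally show ?thesis ..
  qed
  have em: "emeasure \<nu> (A k) = (\<integral>\<^sup>+ r. indicator (A k \<inter> {0..}) r * ennreal (lam r) \<partial>lborel)" for k
    unfolding \<nu>_def by (subst emeasure_density)
      (auto intro!: nn_integral_cong split: split_indicator)
  have pc: "poisson_count M (count_pts R (A k)) (emeasure \<nu> (A k))" for k
    using ppp A unfolding PPP_def em by blast
  have cm: "count_pts R (A k) \<in> borel_measurable M" for k
    using pc by (simp add: poisson_count_def)
  have indep: "indep_vars (\<lambda>_. borel) (\<lambda>k. count_pts R (A k)) I"
    using ppp I disj A unfolding PPP_def by blast
  have "(\<Sum>i. h (R i \<omega>)) = (\<Sum>k\<in>I. g k * count_pts R (A k) \<omega>)" for \<omega>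
  proof -
    have "(\<Sum>i. h (R i \<omega>)) = (\<Sum>i. \<Sum>k\<in>I. g k * indicator (A k) (R i \<omega>))"
      by (subst rep[of "\<lambda>x. x"]) simp
    also have "\<dots> = (\<Sum>k\<in>I. \<Sum>i. g k * indicator (A k) (R i \<omega>))"
      by (rule suminf_sum) auto
    finally show ?thesis by (simp add: count_pts_def)
  qed
  then have "(\<integral>\<^sup>+\<omega>. exp_neg (\<Sum>i. h (R i \<omega>)) \<partial>M)
     = (\<integral>\<^sup>+\<omega>. (\<Prod>k\<in>I. exp_neg (g k * count_pts R (A k) \<omega>)) \<partial>M)"
    by (simp add: exp_neg_sum)
  also have "\<dots> = (\<Prod>k\<in>I. \<integral>\<^sup>+\<omega>. exp_neg (g k * count_pts R (A k) \<omega>) \<partial>M)"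
    using I by (intro indep_vars_nn_integral indep_vars_compose2[OF indep]) auto
  also have "\<dots> = (\<Prod>k\<in>I. exp_neg ((1 - exp_neg (g k)) * emeasure \<nu> (A k)))"
    by (intro prod.cong refl poisson_count_laplace pc)
  also have "\<dots> = exp_neg (\<Sum>k\<in>I. (1 - exp_neg (g k)) * emeasure \<nu> (A k))"
    by (simp add: exp_neg_sum)
  also have "(\<Sum>k\<in>I. (1 - exp_neg (g k)) * emeasure \<nu> (A k))
     = (\<integral>\<^sup>+x. (\<Sum>k\<in>I. (1 - exp_neg (g k)) * indicator (A k) x) \<partial>\<nu>)"
    by (subst nn_integral_sum) (auto simp: \<nu>_def nn_integral_cmult_indicator)
  also have "\<dots> = (\<integral>\<^sup>+x. (1 - exp_neg (h x)) \<partial>\<nu>)"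
    by (intro nn_integral_cong rep[of "\<lambda>y. 1 - exp_neg y", symmetric])
  finally show ?thesis .
qed

text \<open>Simple functions increase to \<open>h\<close>, and continuity of \<open>exp_neg\<close>,
  also at infinity, carries both sides to the limit.\<close>

lemma PPP_imp_poisson_laplace:
  assumes ppp: "PPP M R lam" and lam[measurable]: "lam \<in> borel_measurable borel"
  shows "poisson_laplace M R (density lborel (\<lambda>r. indicator {0..} r * ennreal (lam r)))"
    (is "poisson_laplace M R ?\<nu>")
  unfolding poisson_laplace_def
proof (intro conjI ballI)
  interpret prob_space M using ppp by (simp add: PPP_def)
  show "prob_space M" by (rule prob_space_axioms)
  have R[measurable]: "R i \<in> borel_measurable M" for i
    using ppp by (auto simp: PPP_def)
  then show "\<forall>i. R i \<in> measurable M ?\<nu>" by simp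
  fix h :: "real \<Rightarrow> ennreal" assume "h \<in> borel_measurable ?\<nu>"
  then have h[measurable]: "h \<in> borel_measurable borel" by simp
  obtain f where f: "\<And>n. simple_function borel (f n)" "incseq f" "\<And>x. (SUP n. f n x) = h x"
    using borel_measurable_implies_simple_function_sequence'[OF h] by metis
  have fm[measurable]: "f n \<in> borel_measurable borel" for n
    using f(1) by (rule borel_measurable_simple_function)
  have inc: "incseq (\<lambda>n. f n x)" for x
    using f(2) by (auto simp: incseq_def le_fun_def)
  have lim: "(\<lambda>n. f n x) \<longlonglongrightarrow> h x" for x
    using LIMSEQ_SUP[OF inc[of x]] f(3) by simp
  have "(\<lambda>n. \<Sum>i. f n (R i \<omega>)) \<longlonglongrightarrow> (SUP n. \<Sum>i. f n (R i \<omega>))" for \<omega>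
    using inc by (intro LIMSEQ_SUP) (auto simp: incseq_def intro!: suminf_le)
  then have lim_sum: "(\<lambda>n. \<Sum>i. f n (R i \<omega>)) \<longlonglongrightarrow> (\<Sum>i. h (R i \<omega>))" for \<omega>
    by (subst (asm) ennreal_suminf_SUP_eq[symmetric, OF inc]) (simp add: f(3))
  \<comment> \<open>These integrands decrease in n, so the bound 1 on a probability space is used;
    the intensity integrands below increase, so monotone convergence applies there even to infinite
    integrals.\<close>
  have "(\<lambda>n. \<integral>\<^sup>+\<omega>. exp_neg (\<Sum>i. f n (R i \<omega>)) \<partial>M) \<longlonglongrightarrow> (\<integral>\<^sup>+\<omega>. exp_neg (\<Sum>i. h (R i \<omega>)) \<partial>M)"
    by (rule nn_integral_dominated_convergence[where w="\<lambda>_. 1"])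
       (use emeasure_space_1 in \<open>auto intro!: tendsto_exp_neg lim_sum\<close>)
  moreover have "(\<lambda>n. \<integral>\<^sup>+x. (1 - exp_neg (f n x)) \<partial>?\<nu>) \<longlonglongrightarrow> (\<integral>\<^sup>+x. (1 - exp_neg (h x)) \<partial>?\<nu>)"
  proof (rule nn_integral_LIMSEQ)
    show "incseq (\<lambda>n x. 1 - exp_neg (f n x))"
      using inc by (auto simp: incseq_def le_fun_def intro!: ennreal_minus_mono exp_neg_antimono)
    show "(\<lambda>n. 1 - exp_neg (f n x)) \<longlonglongrightarrow> 1 - exp_neg (h x)" for x
      by (intro tendsto_diff_ennreal tendsto_const tendsto_exp_neg lim) auto
  qed auto
  then have "(\<lambda>n. exp_neg (\<integral>\<^sup>+x. (1 - exp_neg (f n x)) \<partial>?\<nu>)) \<longlonglongrightarrow>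
       exp_neg (\<integral>\<^sup>+x. (1 - exp_neg (h x)) \<partial>?\<nu>)"
    by (rule tendsto_exp_neg)
  ultimately show "(\<integral>\<^sup>+\<omega>. exp_neg (\<Sum>i. h (R i \<omega>)) \<partial>M) = exp_neg (\<integral>\<^sup>+x. (1 - exp_neg (h x)) \<partial>?\<nu>)"
    unfolding PPP_laplace_simple[OF ppp lam f(1)] by (rule LIMSEQ_unique)
qed

lemma poisson_laplace_distr:
  assumes X: "poisson_laplace M X \<nu>" and g[measurable]: "g \<in> measurable \<nu> N"
  shows "poisson_laplace M (\<lambda>i \<omega>. g (X i \<omega>)) (distr \<nu> N g)"
proof -
  have "X i \<in> measurable M \<nu>" for i
    using X by (simp add: poisson_laplace_def)
  then have "(\<lambda>\<omega>. g (X i \<omega>)) \<in> measurable M N" for i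
    using g by (rule measurable_compose)
  then show ?thesis
    using X unfolding poisson_laplace_def by (auto simp: nn_integral_distr)
qed

text \<open>With the points held fixed, independent marks average factor by factor:
  \<open>exp_neg (h (r, y))\<close> becomes its mean \<open>E r\<close>. Writing \<open>E r\<close>
  as \<open>exp_neg (g r)\<close> reduces the claim to the Laplace functional of the unmarked
  process at \<open>g\<close>.\<close>

lemma poisson_laplace_marking:
  fixes X :: "nat \<Rightarrow> 'a \<Rightarrow> 'b" and Y :: "nat \<Rightarrow> 'a \<Rightarrow> 'c"
  assumes X: "poisson_laplace M X \<nu>" and D: "prob_space D"
    and Y[measurable]: "\<And>i. Y i \<in> measurable M D" and law: "\<And>i. distr M D (Y i) = D"
    and Y_indep: "prob_space.indep_vars M (\<lambda>_. D) Y UNIV"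
    and XY_indep: "prob_space.indep_set M
      (sets (vimage_algebra (space M) (\<lambda>\<omega> i. X i \<omega>) (PiM UNIV (\<lambda>_. \<nu>))))
      (sets (vimage_algebra (space M) (\<lambda>\<omega> i. Y i \<omega>) (PiM UNIV (\<lambda>_. D))))"
  shows "poisson_laplace M (\<lambda>i \<omega>. (X i \<omega>, Y i \<omega>)) (\<nu> \<Otimes>\<^sub>M D)"
  unfolding poisson_laplace_def
proof (intro conjI ballI allI)
  interpret prob_space M using X by (simp add: poisson_laplace_def)
  interpret D: prob_space D by fact
  show "prob_space M" by (rule prob_space_axioms)
  have Xm[measurable]: "X i \<in> measurable M \<nu>" for i
    using X by (auto simp: poisson_laplace_def)
  show "(\<lambda>\<omega>. (X i \<omega>, Y i \<omega>)) \<in> measurable M (\<nu> \<Otimes>\<^sub>M D)" for i by measurable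
  fix h :: "'b \<times> 'c \<Rightarrow> ennreal" assume h[measurable]: "h \<in> borel_measurable (\<nu> \<Otimes>\<^sub>M D)"
  define E where "E r = (\<integral>\<^sup>+y. exp_neg (h (r, y)) \<partial>D)" for r
  have E_meas[measurable]: "E \<in> borel_measurable \<nu>"
    unfolding E_def by measurable
  have E_le: "E r \<le> 1" for r
  proof -
    have "E r \<le> (\<integral>\<^sup>+y. 1 \<partial>D)" unfolding E_def by (intro nn_integral_mono) auto
    then show ?thesis using D.emeasure_space_1 by simp
  qed
  define g where "g r = log_neg (E r)" for r
  have g_meas[measurable]: "g \<in> borel_measurable \<nu>" unfolding g_def by measurable
  have exp_g: "exp_neg (g r) = E r" for r
    unfolding g_def by (intro exp_neg_log_neg E_le)
  let ?PX = "PiM UNIV (\<lambda>_::nat. \<nu>)" and ?PY = "PiM UNIV (\<lambda>_::nat. D)"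
  let ?X = "\<lambda>\<omega> i. X i \<omega>" and ?Y = "\<lambda>\<omega> i. Y i \<omega>"
  have XX[measurable]: "?X \<in> measurable M ?PX" by (intro measurable_PiM_single') (auto intro: measurable_space[OF Xm] measurable_space[OF Y])
  have YY[measurable]: "?Y \<in> measurable M ?PY" by (intro measurable_PiM_single') (auto intro: measurable_space[OF Xm] measurable_space[OF Y])
  interpret PX: prob_space "distr M ?PX ?X" by (rule prob_space_distr) fact
  interpret PY: prob_space "distr M ?PY ?Y" by (rule prob_space_distr) fact
  \<comment> \<open>Independence of the two generated sigma-algebras makes the joint law of the
    whole sequences a product, so Fubini can integrate out the marks first.\<close>
  have prod: "distr M ?PX ?X \<Otimes>\<^sub>M distr M ?PY ?Y = distr M (?PX \<Otimes>\<^sub>M ?PY) (\<lambda>\<omega>. (?X \<omega>, ?Y \<omega>))"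
  proof (rule pair_measure_eqI)
    fix A B assume "A \<in> sets (distr M ?PX ?X)" "B \<in> sets (distr M ?PY ?Y)"
    then have [measurable]: "A \<in> sets ?PX" "B \<in> sets ?PY" by simp_all
    have "prob ((?X -` A \<inter> space M) \<inter> (?Y -` B \<inter> space M))
        = prob (?X -` A \<inter> space M) * prob (?Y -` B \<inter> space M)"
      by (rule indep_setD[OF XY_indep in_vimage_algebra in_vimage_algebra]) fact+
    moreover have "(\<lambda>\<omega>. (?X \<omega>, ?Y \<omega>)) -` (A \<times> B) \<inter> space M
        = (?X -` A \<inter> space M) \<inter> (?Y -` B \<inter> space M)" by auto
    ultimately show "emeasure (distr M ?PX ?X) A * emeasure (distr M ?PY ?Y) B
        = emeasure (distr M (?PX \<Otimes>\<^sub>M ?PY) (\<lambda>\<omega>. (?X \<omega>, ?Y \<omega>))) (A \<times> B)"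
      by (simp add: emeasure_distr emeasure_eq_measure ennreal_mult)
  qed (simp_all add: PX.sigma_finite_measure PY.sigma_finite_measure)
  \<comment> \<open>Independence of the marks factors finite products; the passage to the full
    series follows by dominated convergence in \<open>lim\<close>.\<close>
  have finite_marks: "(\<integral>\<^sup>+\<omega>. exp_neg (\<Sum>i<n. h (X i \<omega>, Y i \<omega>)) \<partial>M)
      = (\<integral>\<^sup>+\<omega>. exp_neg (\<Sum>i<n. g (X i \<omega>)) \<partial>M)" for n :: nat
  proof -
    define F where "F p = (\<Prod>i<n. exp_neg (h (fst p i, snd p i)))" for p :: "(nat \<Rightarrow> 'b) \<times> (nat \<Rightarrow> 'c)"
    have F[measurable]: "F \<in> borel_measurable (?PX \<Otimes>\<^sub>M ?PY)"
      unfolding F_def by measurable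
    have inner: "(\<integral>\<^sup>+y. F (x, y) \<partial>distr M ?PY ?Y) = (\<Prod>i<n. E (x i))" if x: "x \<in> space ?PX" for x
    proof -
      have hx: "(\<lambda>y. exp_neg (h (x i, y))) \<in> borel_measurable D" for i
      proof -
        have "x i \<in> space \<nu>" using x by (auto simp: space_PiM)
        then show ?thesis by measurable
      qed
      have "(\<integral>\<^sup>+y. F (x, y) \<partial>distr M ?PY ?Y) = (\<integral>\<^sup>+\<omega>. F (x, ?Y \<omega>) \<partial>M)"
        using x by (intro nn_integral_distr) auto
      also have "\<dots> = (\<integral>\<^sup>+\<omega>. (\<Prod>i<n. exp_neg (h (x i, Y i \<omega>))) \<partial>M)"
        by (simp add: F_def)
      also have "\<dots> = (\<Prod>i<n. \<integral>\<^sup>+\<omega>. exp_neg (h (x i, Y i \<omega>)) \<partial>M)"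
        using hx by (intro indep_vars_nn_integral
            indep_vars_compose2[OF indep_vars_subset[OF Y_indep]]) auto
      also have "\<dots> = (\<Prod>i<n. E (x i))"
      proof (intro prod.cong refl)
        fix i
        have "(\<integral>\<^sup>+\<omega>. exp_neg (h (x i, Y i \<omega>)) \<partial>M) = (\<integral>\<^sup>+y. exp_neg (h (x i, y)) \<partial>distr M D (Y i))"
          using hx by (subst nn_integral_distr) auto
        then show "(\<integral>\<^sup>+\<omega>. exp_neg (h (x i, Y i \<omega>)) \<partial>M) = E (x i)"
          by (simp add: law E_def)
      qed
      finally show ?thesis .
    qed
    have "(\<integral>\<^sup>+\<omega>. exp_neg (\<Sum>i<n. h (X i \<omega>, Y i \<omega>)) \<partial>M) = (\<integral>\<^sup>+\<omega>. F (?X \<omega>, ?Y \<omega>) \<partial>M)"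
      by (simp add: F_def exp_neg_sum)
    also have "\<dots> = (\<integral>\<^sup>+p. F p \<partial>distr M (?PX \<Otimes>\<^sub>M ?PY) (\<lambda>\<omega>. (?X \<omega>, ?Y \<omega>)))"
      by (subst nn_integral_distr) auto
    also have "\<dots> = (\<integral>\<^sup>+x. \<integral>\<^sup>+y. F (x, y) \<partial>distr M ?PY ?Y \<partial>distr M ?PX ?X)"
      unfolding prod[symmetric] by (subst PY.nn_integral_fst[symmetric]) auto
    also have "\<dots> = (\<integral>\<^sup>+x. (\<Prod>i<n. E (x i)) \<partial>distr M ?PX ?X)"
      by (intro nn_integral_cong inner) auto
    also have "\<dots> = (\<integral>\<^sup>+\<omega>. (\<Prod>i<n. E (X i \<omega>)) \<partial>M)"
      by (subst nn_integral_distr) auto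
    finally show ?thesis by (simp add: exp_neg_sum exp_g)
  qed
  have lim: "(\<lambda>n. \<integral>\<^sup>+\<omega>. exp_neg (\<Sum>i<n. f i \<omega>) \<partial>M) \<longlonglongrightarrow> (\<integral>\<^sup>+\<omega>. exp_neg (\<Sum>i. f i \<omega>) \<partial>M)"
    if [measurable]: "\<And>i. f i \<in> borel_measurable M" for f :: "nat \<Rightarrow> 'a \<Rightarrow> ennreal"
    by (rule nn_integral_dominated_convergence[where w="\<lambda>_. 1"])
       (use emeasure_space_1 in \<open>auto intro!: tendsto_exp_neg summable_LIMSEQ\<close>)
  have "(\<integral>\<^sup>+\<omega>. exp_neg (\<Sum>i. h (X i \<omega>, Y i \<omega>)) \<partial>M) = (\<integral>\<^sup>+\<omega>. exp_neg (\<Sum>i. g (X i \<omega>)) \<partial>M)"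
    using lim[of "\<lambda>i \<omega>. h (X i \<omega>, Y i \<omega>)"] lim[of "\<lambda>i \<omega>. g (X i \<omega>)"]
    unfolding finite_marks by (intro LIMSEQ_unique) auto
  also have "\<dots> = exp_neg (\<integral>\<^sup>+r. (1 - exp_neg (g r)) \<partial>\<nu>)"
    using X by (simp add: poisson_laplace_def)
  \<comment> \<open>Since \<open>D\<close> has mass 1, \<open>1 - E r\<close> is the mean of
    \<open>1 - exp_neg (h (r, y))\<close> over the mark.\<close>
  also have "(\<integral>\<^sup>+r. (1 - exp_neg (g r)) \<partial>\<nu>) = (\<integral>\<^sup>+r. \<integral>\<^sup>+y. (1 - exp_neg (h (r, y))) \<partial>D \<partial>\<nu>)"
  proof (intro nn_integral_cong)
    fix r assume r: "r \<in> space \<nu>"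
    have "(\<integral>\<^sup>+y. (1 - exp_neg (h (r, y))) \<partial>D) = (\<integral>\<^sup>+y. 1 \<partial>D) - E r"
      unfolding E_def
    proof (rule nn_integral_diff)
      show "(\<integral>\<^sup>+y. exp_neg (h (r, y)) \<partial>D) \<noteq> \<infinity>"
        using E_le[of r] by (auto simp: E_def top_unique)
    qed (use r in auto)
    then show "1 - exp_neg (g r) = (\<integral>\<^sup>+y. (1 - exp_neg (h (r, y))) \<partial>D)"
      using D.emeasure_space_1 by (simp add: exp_g)
  qed
  also have "\<dots> = (\<integral>\<^sup>+p. (1 - exp_neg (h p)) \<partial>(\<nu> \<Otimes>\<^sub>M D))"
    by (rule D.nn_integral_fst) measurable
  finally show "(\<integral>\<^sup>+\<omega>. exp_neg (\<Sum>i. h (X i \<omega>, Y i \<omega>)) \<partial>M)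
     = exp_neg (\<integral>\<^sup>+p. (1 - exp_neg (h p)) \<partial>(\<nu> \<Otimes>\<^sub>M D))" .
qed

section \<open>Joint law of the supremum and the sum\<close>

text \<open>Equal moments give equal integrals of polynomials, by Weierstrass of continuous
  functions, and by ramp functions equal distribution functions. The moment of order 0 fixes the
  total mass, so subprobability measures are covered.\<close>

lemma measure_eqI_moments:
  fixes \<mu> \<mu>' :: "real measure"
  assumes fin: "finite_measure \<mu>" "finite_measure \<mu>'"
    and sets: "sets \<mu> = sets borel" "sets \<mu>' = sets borel"
    and unit: "AE x in \<mu>. x \<in> {0..1}" "AE x in \<mu>'. x \<in> {0..1}"
    and moments: "\<And>n. (\<integral>x. x ^ n \<partial>\<mu>) = (\<integral>x. x ^ n \<partial>\<mu>')"
  shows "\<mu> = \<mu>'"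
proof -
  interpret m: finite_measure \<mu> by fact
  interpret m': finite_measure \<mu>' by fact
  have [measurable_cong]: "sets \<mu> = sets borel" "sets \<mu>' = sets borel" by fact+
  have bound: "integrable m f \<and> \<bar>\<integral>x. f x \<partial>m\<bar> \<le> B * measure m (space m)"
    if m: "finite_measure m" "sets m = sets borel" "AE x in m. x \<in> {0..1}"
      and f: "f \<in> borel_measurable borel" "\<And>x. x \<in> {0..1} \<Longrightarrow> \<bar>f x\<bar> \<le> B"
    for f :: "real \<Rightarrow> real" and B and m :: "real measure"
  proof -
    interpret finite_measure m by fact
    have [measurable]: "f \<in> borel_measurable m" using f m by (simp cong: measurable_cong_sets)
    have AE: "AE x in m. \<bar>f x\<bar> \<le> B" using m(3) f(2) by (auto elim: eventually_mono)
    then have i: "integrable m f" by (intro integrable_const_bound[where B=B]) auto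
    have "\<bar>\<integral>x. f x \<partial>m\<bar> \<le> (\<integral>x. \<bar>f x\<bar> \<partial>m)" by (rule integral_abs_bound)
    also have "\<dots> \<le> (\<integral>x. B \<partial>m)" using i AE by (intro integral_mono_AE) auto
    finally show ?thesis using i by (simp add: mult.commute)
  qed
  have cont_int: "integrable m f"
    if "finite_measure m" "sets m = sets borel" "AE x in m. x \<in> {0..1}" "continuous_on UNIV f"
    for f :: "real \<Rightarrow> real" and m :: "real measure"
  proof -
    have "compact (f ` {0..1})"
      using that(4) by (intro compact_continuous_image) (auto intro: continuous_on_subset)
    then obtain B where "\<forall>x\<in>f ` {0..1}. norm x \<le> B"
      using compact_imp_bounded bounded_iff by metis
    then show ?thesis
      using bound[OF that(1-3), of f B] borel_measurable_continuous_onI[OF that(4)] by auto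
  qed
  have poly: "(\<integral>x. p x \<partial>\<mu>) = (\<integral>x. p x \<partial>\<mu>')" if poly: "real_polynomial_function p" for p :: "real \<Rightarrow> real"
  proof -
    obtain a n where p: "p = (\<lambda>x. \<Sum>i\<le>n. a i * x ^ i)"
      using real_polynomial_function_imp_sum[OF poly] by auto
    have "integrable \<mu> (\<lambda>x. a i * x ^ i)" "integrable \<mu>' (\<lambda>x. a i * x ^ i)" for i
      using fin sets unit by (auto intro!: cont_int continuous_intros)
    then show ?thesis
      unfolding p by (simp add: moments)
  qed
  have cont: "(\<integral>x. f x \<partial>\<mu>) = (\<integral>x. f x \<partial>\<mu>')" if f: "continuous_on UNIV f" for f :: "real \<Rightarrow> real"
  proof (rule ccontr)
    define d where "d = \<bar>(\<integral>x. f x \<partial>\<mu>) - (\<integral>x. f x \<partial>\<mu>')\<bar>"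
    define c where "c = measure \<mu> (space \<mu>) + measure \<mu>' (space \<mu>')"
    assume "(\<integral>x. f x \<partial>\<mu>) \<noteq> (\<integral>x. f x \<partial>\<mu>')"
    then have d: "d > 0" by (simp add: d_def)
    have c: "c \<ge> 0" by (simp add: c_def)
    \<comment> \<open>An error below \<open>e\<close> on [0, 1] moves the two integrals by at most
      \<open>e * c\<close> in total. The denominator \<open>c + 1\<close> makes this smaller than
      \<open>d\<close> and is nonzero even for null measures.\<close>
    define e where "e = d / (c + 1)"
    have e: "e > 0" using c d by (simp add: e_def)
    obtain p where p: "real_polynomial_function p" "\<And>x. x \<in> {0..1} \<Longrightarrow> \<bar>f x - p x\<bar> < e"
      using Stone_Weierstrass_real_polynomial_function[of "{0..1}" f e] f e
      by (metis compact_Icc continuous_on_subset subset_UNIV)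
    have pc: "continuous_on UNIV p"
      using p(1) by (simp add: real_polynomial_function_eq continuous_on_polymonial_function)
    have fpm: "(\<lambda>x. f x - p x) \<in> borel_measurable borel"
      using f pc by (intro borel_measurable_continuous_onI continuous_intros)
    have ints: "integrable \<mu> f" "integrable \<mu>' f" "integrable \<mu> p" "integrable \<mu>' p"
      using fin sets unit f pc by (auto intro!: cont_int)
    have "\<bar>\<integral>x. f x - p x \<partial>\<mu>\<bar> \<le> e * measure \<mu> (space \<mu>)"
      using bound[OF fin(1) sets(1) unit(1) fpm] p(2) by (meson less_imp_le)
    moreover have "\<bar>\<integral>x. f x - p x \<partial>\<mu>'\<bar> \<le> e * measure \<mu>' (space \<mu>')"
      using bound[OF fin(2) sets(2) unit(2) fpm] p(2) by (meson less_imp_le)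
    ultimately have "d \<le> e * c"
      using ints poly[OF p(1)] by (simp add: d_def c_def distrib_left)
    also have "\<dots> < e * (c + 1)" using e by simp
    also have "\<dots> = d" using c by (simp add: e_def)
    finally show False by simp
  qed
  have Iic: "measure \<mu> {..a} = measure \<mu>' {..a}" for a :: real
  proof -
    \<comment> \<open>For n > 0 this ramp is 1 up to a and falls linearly to 0 at a + 1/n.\<close>
    define f where "f n x = max 0 (min 1 (1 - real n * (x - a)))" for n x
    have fc: "continuous_on UNIV (f n)" for n
      unfolding f_def by (intro continuous_intros)
    then have fm[measurable]: "f n \<in> borel_measurable borel" for n
      by (rule borel_measurable_continuous_onI)
    have f_lim: "(\<lambda>n. f n x) \<longlonglongrightarrow> indicator {..a} x" for x
    proof (cases "x \<le> a")
      case True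
      then have "f n x = 1" for n
        by (simp add: f_def min_def mult_nonneg_nonpos)
      then show ?thesis using True by simp
    next
      case False
      then obtain k where k: "1 < real k * (x - a)"
        using reals_Archimedean3[of "x - a"] by auto
      have "f n x = 0" if "n \<ge> k" for n
      proof -
        have "real k * (x - a) \<le> real n * (x - a)" using that False by (intro mult_right_mono) auto
        then show ?thesis using k by (simp add: f_def)
      qed
      then have "eventually (\<lambda>n. f n x = 0) sequentially"
        by (auto simp: eventually_sequentially)
      then show ?thesis using False by (auto intro: tendsto_eventually)
    qed
    have lim: "(\<lambda>n. \<integral>x. f n x \<partial>m) \<longlonglongrightarrow> measure m {..a}"
      if m: "finite_measure m" "sets m = sets borel" for m :: "real measure"
    proof -
      interpret finite_measure m by fact
      have [measurable_cong]: "sets m = sets borel" by fact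
      have "(\<lambda>n. \<integral>x. f n x \<partial>m) \<longlonglongrightarrow> (\<integral>x. indicator {..a} x \<partial>m)"
        by (rule integral_dominated_convergence[where w="\<lambda>_. 1"])
           (auto intro!: f_lim, auto simp: f_def)
      then show ?thesis
        using sets_eq_imp_space_eq[OF m(2)] by simp
    qed
    show ?thesis
      using lim[OF fin(1) sets(1)] lim[OF fin(2) sets(2)] unfolding cont[OF fc]
      by (rule LIMSEQ_unique)
  qed
  show ?thesis
  proof (rule measure_eqI_generator_eq[where E="range atMost" and A="\<lambda>n. {..real n}" and \<Omega>=UNIV])
    show "Int_stable (range (atMost :: real \<Rightarrow> _))"
      by (auto simp: Int_stable_def)
    show "sets \<mu> = sigma_sets UNIV (range atMost)" "sets \<mu>' = sigma_sets UNIV (range atMost)"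
      unfolding sets by (simp_all add: borel_eq_atMost)
    show "(\<Union>n. {..real n}) = UNIV" by (auto intro: real_arch_simple)
  qed (auto simp: m.emeasure_eq_measure m'.emeasure_eq_measure Iic)
qed

lemma sets_borel_atMost: "sets (borel :: ennreal measure) = sigma_sets UNIV (range atMost)"
proof
  have "sets (borel :: ennreal measure) = sigma_sets UNIV (range greaterThan)"
    by (subst borel_Ioi) (rule sets_measure_of, simp)
  also have "\<dots> \<subseteq> sigma_sets UNIV (range atMost)"
  proof (rule sigma_sets_mono, safe)
    fix a :: ennreal
    have "{a<..} = UNIV - {..a}" by auto
    also have "\<dots> \<in> sigma_sets UNIV (range atMost)"
      by (intro sigma_sets.Compl sigma_sets.Basic) auto
    finally show "{a<..} \<in> sigma_sets UNIV (range atMost)" .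
  qed
  finally show "sets (borel :: ennreal measure) \<subseteq> sigma_sets UNIV (range atMost)" .
  show "sigma_sets UNIV (range atMost) \<subseteq> sets (borel :: ennreal measure)"
    by (rule sets.sigma_sets_subset[of _ "borel :: ennreal measure", simplified space_borel]) auto
qed

text \<open>An event about a pair becomes the value of a measure in one variable, so uniqueness
  theorems can be applied to one coordinate at a time.\<close>

lemma emeasure_distr_density_indicator:
  assumes [measurable]: "S \<in> measurable M N" "V \<in> measurable M L" "A \<in> sets N" "B \<in> sets L"
  shows "emeasure (distr (density M (\<lambda>\<omega>. indicator A (S \<omega>))) L V) B
    = emeasure M {\<omega>\<in>space M. S \<omega> \<in> A \<and> V \<omega> \<in> B}"
proof -
  have "emeasure (distr (density M (\<lambda>\<omega>. indicator A (S \<omega>))) L V) B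
    = (\<integral>\<^sup>+\<omega>. indicator A (S \<omega>) * indicator (V -` B \<inter> space M) \<omega> \<partial>M)"
    by (simp add: emeasure_distr emeasure_density)
  also have "\<dots> = (\<integral>\<^sup>+\<omega>. indicator {\<omega>\<in>space M. S \<omega> \<in> A \<and> V \<omega> \<in> B} \<omega> \<partial>M)"
    by (intro nn_integral_cong) (auto split: split_indicator)
  finally show ?thesis by simp
qed

text \<open>The coordinates are released in turn: half-lines for \<open>S\<close> against moments of
  \<open>V\<close>, then half-lines against Borel sets, then Borel rectangles, which form an
  intersection-stable generator.\<close>

lemma joint_law_eqI_moments:
  fixes S :: "'a \<Rightarrow> ennreal" and S' :: "'b \<Rightarrow> ennreal" and V :: "'a \<Rightarrow> real" and V' :: "'b \<Rightarrow> real"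
  assumes "prob_space M" "prob_space M'"
    and meas[measurable]: "S \<in> borel_measurable M" "V \<in> borel_measurable M"
      "S' \<in> borel_measurable M'" "V' \<in> borel_measurable M'"
    and unit: "\<And>\<omega>. V \<omega> \<in> {0..1}" "\<And>\<omega>. V' \<omega> \<in> {0..1}"
    and moments: "\<And>t n. (\<integral>\<^sup>+\<omega>. indicator {..t} (S \<omega>) * ennreal (V \<omega> ^ n) \<partial>M)
       = (\<integral>\<^sup>+\<omega>. indicator {..t} (S' \<omega>) * ennreal (V' \<omega> ^ n) \<partial>M')"
  shows "distr M (borel \<Otimes>\<^sub>M borel) (\<lambda>\<omega>. (S \<omega>, V \<omega>)) = distr M' (borel \<Otimes>\<^sub>M borel) (\<lambda>\<omega>. (S' \<omega>, V' \<omega>))"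
    (is "?L = ?L'")
proof -
  interpret M: prob_space M by fact
  interpret M': prob_space M' by fact
  have step: "emeasure M {\<omega>\<in>space M. S \<omega> \<le> t \<and> V \<omega> \<in> B} = emeasure M' {\<omega>\<in>space M'. S' \<omega> \<le> t \<and> V' \<omega> \<in> B}"
    if B[measurable]: "B \<in> sets borel" for t B
  proof -
    define \<mu> where "\<mu> = distr (density M (\<lambda>\<omega>. indicator {..t} (S \<omega>))) borel V"
    define \<mu>' where "\<mu>' = distr (density M' (\<lambda>\<omega>. indicator {..t} (S' \<omega>))) borel V'"
    have em: "emeasure \<mu> A = emeasure M {\<omega>\<in>space M. S \<omega> \<le> t \<and> V \<omega> \<in> A}"
      and em': "emeasure \<mu>' A = emeasure M' {\<omega>\<in>space M'. S' \<omega> \<le> t \<and> V' \<omega> \<in> A}"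
      if [measurable]: "A \<in> sets borel" for A
      unfolding \<mu>_def \<mu>'_def by (auto simp: emeasure_distr_density_indicator[where N=borel] conj_commute)
    have nn: "(\<integral>\<^sup>+x. ennreal (x ^ n) \<partial>\<mu>) = (\<integral>\<^sup>+\<omega>. indicator {..t} (S \<omega>) * ennreal (V \<omega> ^ n) \<partial>M)"
      and nn': "(\<integral>\<^sup>+x. ennreal (x ^ n) \<partial>\<mu>') = (\<integral>\<^sup>+\<omega>. indicator {..t} (S' \<omega>) * ennreal (V' \<omega> ^ n) \<partial>M')" for n
      unfolding \<mu>_def \<mu>'_def by (simp_all add: nn_integral_distr nn_integral_density)
    have AE: "AE x in \<mu>. x \<in> {0..1}" "AE x in \<mu>'. x \<in> {0..1}"
      unfolding \<mu>_def \<mu>'_def using unit by (subst AE_distr_iff; auto)+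
    have "\<mu> = \<mu>'"
    proof (rule measure_eqI_moments[OF _ _ _ _ AE])
      show "finite_measure \<mu>" "finite_measure \<mu>'"
        by (intro finite_measureI; simp add: em em' \<mu>_def[THEN arg_cong[of _ _ space]]
              \<mu>'_def[THEN arg_cong[of _ _ space]])+
      show "sets \<mu> = sets borel" "sets \<mu>' = sets borel" by (simp_all add: \<mu>_def \<mu>'_def)
      show "(\<integral>x. x ^ n \<partial>\<mu>) = (\<integral>x. x ^ n \<partial>\<mu>')" for n
      proof -
        have "(\<integral>x. x ^ n \<partial>\<mu>) = enn2real (\<integral>\<^sup>+x. ennreal (x ^ n) \<partial>\<mu>)"
          using AE(1) by (intro integral_eq_nn_integral) (auto simp: \<mu>_def elim!: eventually_mono)
        also have "\<dots> = enn2real (\<integral>\<^sup>+x. ennreal (x ^ n) \<partial>\<mu>')"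
          by (simp add: nn nn' moments)
        also have "\<dots> = (\<integral>x. x ^ n \<partial>\<mu>')"
          using AE(2) by (intro integral_eq_nn_integral[symmetric]) (auto simp: \<mu>'_def elim!: eventually_mono)
        finally show ?thesis .
      qed
    qed
    then show ?thesis using em[OF B] em'[OF B] by simp
  qed
  have rect: "emeasure M {\<omega>\<in>space M. S \<omega> \<in> A \<and> V \<omega> \<in> B} = emeasure M' {\<omega>\<in>space M'. S' \<omega> \<in> A \<and> V' \<omega> \<in> B}"
    if A[measurable]: "A \<in> sets borel" and B[measurable]: "B \<in> sets borel" for A B
  proof -
    define \<mu> where "\<mu> = distr (density M (\<lambda>\<omega>. indicator B (V \<omega>))) borel S"
    define \<mu>' where "\<mu>' = distr (density M' (\<lambda>\<omega>. indicator B (V' \<omega>))) borel S'"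
    have em: "emeasure \<mu> A = emeasure M {\<omega>\<in>space M. S \<omega> \<in> A \<and> V \<omega> \<in> B}"
      and em': "emeasure \<mu>' A = emeasure M' {\<omega>\<in>space M'. S' \<omega> \<in> A \<and> V' \<omega> \<in> B}"
      if [measurable]: "A \<in> sets borel" for A
      unfolding \<mu>_def \<mu>'_def by (auto simp: emeasure_distr_density_indicator[where N=borel] conj_commute)
    have "\<mu> = \<mu>'"
    proof (rule measure_eqI_generator_eq[where E="range atMost" and A="\<lambda>_. {..\<top>}" and \<Omega>=UNIV])
      show "Int_stable (range (atMost :: ennreal \<Rightarrow> _))"
        by (auto simp: Int_stable_def)
      show "sets \<mu> = sigma_sets UNIV (range atMost)" "sets \<mu>' = sigma_sets UNIV (range atMost)"
        by (simp_all add: \<mu>_def \<mu>'_def sets_borel_atMost)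
      show "emeasure \<mu> X = emeasure \<mu>' X" if "X \<in> range atMost" for X
        using that step[OF B] by (auto simp: em em')
      show "emeasure \<mu> {..\<top>} \<noteq> \<infinity>" by (simp add: em)
    qed auto
    then show ?thesis using em[OF A] em'[OF A] by simp
  qed
  show ?thesis
  proof (rule measure_eqI_generator_eq[OF Int_stable_pair_measure_generator
        [of "borel :: ennreal measure" "borel :: real measure"], where A="\<lambda>_. UNIV" and \<Omega>="space borel \<times> space borel"])
    show "sets ?L = sigma_sets (space borel \<times> space borel) {a \<times> b |a b. a \<in> sets borel \<and> b \<in> sets borel}"
      "sets ?L' = sigma_sets (space borel \<times> space borel) {a \<times> b |a b. a \<in> sets borel \<and> b \<in> sets borel}"
      by (simp_all add: sets_pair_measure)
    show "emeasure ?L X = emeasure ?L' X"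
      if X: "X \<in> {a \<times> b |a b. a \<in> sets (borel :: ennreal measure) \<and> b \<in> sets (borel :: real measure)}" for X
    proof -
      obtain A B where X: "X = A \<times> B" and [measurable]: "A \<in> sets borel" "B \<in> sets borel"
        using X by auto
      have *: "(\<lambda>\<omega>. (S \<omega>, V \<omega>)) -` (A \<times> B) \<inter> space M = {\<omega>\<in>space M. S \<omega> \<in> A \<and> V \<omega> \<in> B}"
        "(\<lambda>\<omega>. (S' \<omega>, V' \<omega>)) -` (A \<times> B) \<inter> space M' = {\<omega>\<in>space M'. S' \<omega> \<in> A \<and> V' \<omega> \<in> B}"
        by auto
      show ?thesis unfolding X by (simp add: emeasure_distr * rect)
    qed
    show "range (\<lambda>_. UNIV) \<subseteq> {a \<times> b |a b. a \<in> sets (borel :: ennreal measure) \<and> b \<in> sets (borel :: real measure)}"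
      by (auto intro!: exI[of _ UNIV])
    interpret L: prob_space ?L by (rule M.prob_space_distr) simp
    show "emeasure ?L UNIV \<noteq> \<infinity>" by simp
  qed auto
qed

text \<open>The exponential \<open>V\<close> of minus the sum stays in [0, 1] even where the sum
  diverges, so its moments exist, and \<open>log_neg\<close> recovers the sum with the value
  infinity included.\<close>

lemma poisson_laplace_sup_sum:
  assumes X: "poisson_laplace M X \<nu>" and X': "poisson_laplace M' X' \<nu>"
    and sets[measurable_cong]: "sets \<nu> = sets (borel :: ennreal measure)"
  shows "distr M (borel \<Otimes>\<^sub>M borel) (\<lambda>\<omega>. (SUP i. X i \<omega>, \<Sum>i. X i \<omega>))
    = distr M' (borel \<Otimes>\<^sub>M borel) (\<lambda>\<omega>. (SUP i. X' i \<omega>, \<Sum>i. X' i \<omega>))"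
proof -
  interpret M: prob_space M using X by (simp add: poisson_laplace_def)
  interpret M': prob_space M' using X' by (simp add: poisson_laplace_def)
  have [measurable]: "X i \<in> borel_measurable M" "X' i \<in> borel_measurable M'" for i
    using X X' by (simp_all add: poisson_laplace_def measurable_cong_sets[OF refl sets])
  define V where "V x = enn2real (exp_neg (\<Sum>i. x i))" for x :: "nat \<Rightarrow> ennreal"
  have V: "ennreal (V x) = exp_neg (\<Sum>i. x i)" "V x \<in> {0..1}" for x
    by (simp_all add: V_def enn2real_leI)
  have eq: "exp_neg (\<Sum>i. of_nat n * x i + (if x i \<le> t then 0 else \<top>))
      = indicator {..t} (SUP i. x i) * ennreal (V x ^ n)" for x :: "nat \<Rightarrow> ennreal" and t n
  proof -
    \<comment> \<open>A single term above \<open>t\<close> already contributes infinity, so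
      \<open>exp_neg\<close> of this sum is the indicator of a supremum at most
      \<open>t\<close>.\<close>
    have "(\<Sum>i. if x i \<le> t then 0 else \<top> :: ennreal) = (if (SUP i. x i) \<le> t then 0 else \<top>)"
    proof (cases "(SUP i. x i) \<le> t")
      case True
      then have "x i \<le> t" for i by (auto simp: SUP_le_iff)
      then show ?thesis using True by simp
    next
      case False
      then obtain k where k: "\<not> x k \<le> t" by (auto simp: SUP_le_iff)
      have "(\<Sum>i\<in>{k}. if x i \<le> t then 0 else \<top> :: ennreal) \<le> (\<Sum>i. if x i \<le> t then 0 else \<top>)"
        by (rule sum_le_suminf) auto
      then show ?thesis using k False by (simp add: top_unique)
    qed
    then have "(\<Sum>i. of_nat n * x i + (if x i \<le> t then 0 else \<top>))
       = of_nat n * (\<Sum>i. x i) + (if (SUP i. x i) \<le> t then 0 else \<top>)"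
      by (subst suminf_add[symmetric]) auto
    then show ?thesis
      using V(2)[of x] by (simp add: exp_neg_add exp_neg_mult_of_nat V(1)[symmetric] ennreal_power)
  qed
  have "distr M (borel \<Otimes>\<^sub>M borel) (\<lambda>\<omega>. (SUP i. X i \<omega>, V (\<lambda>i. X i \<omega>)))
    = distr M' (borel \<Otimes>\<^sub>M borel) (\<lambda>\<omega>. (SUP i. X' i \<omega>, V (\<lambda>i. X' i \<omega>)))"
  proof (rule joint_law_eqI_moments)
    show "(\<lambda>\<omega>. V (\<lambda>i. X i \<omega>)) \<in> borel_measurable M" "(\<lambda>\<omega>. V (\<lambda>i. X' i \<omega>)) \<in> borel_measurable M'"
      unfolding V_def by measurable
    fix t n
    define h where "h x = of_nat n * x + (if x \<le> t then 0 else \<top>)" for x :: ennreal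
    have "h \<in> borel_measurable \<nu>" unfolding h_def by measurable
    then have "(\<integral>\<^sup>+\<omega>. exp_neg (\<Sum>i. h (X i \<omega>)) \<partial>M) = (\<integral>\<^sup>+\<omega>. exp_neg (\<Sum>i. h (X' i \<omega>)) \<partial>M')"
      using X X' by (simp add: poisson_laplace_def)
    then show "(\<integral>\<^sup>+\<omega>. indicator {..t} (SUP i. X i \<omega>) * ennreal (V (\<lambda>i. X i \<omega>) ^ n) \<partial>M)
       = (\<integral>\<^sup>+\<omega>. indicator {..t} (SUP i. X' i \<omega>) * ennreal (V (\<lambda>i. X' i \<omega>) ^ n) \<partial>M')"
      unfolding h_def eq .
  qed (use V(2) M.prob_space_axioms M'.prob_space_axioms in auto)
  then have "distr (distr M (borel \<Otimes>\<^sub>M borel) (\<lambda>\<omega>. (SUP i. X i \<omega>, V (\<lambda>i. X i \<omega>))))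
      (borel \<Otimes>\<^sub>M borel) (\<lambda>(s, v). (s, log_neg (ennreal v)))
    = distr (distr M' (borel \<Otimes>\<^sub>M borel) (\<lambda>\<omega>. (SUP i. X' i \<omega>, V (\<lambda>i. X' i \<omega>))))
      (borel \<Otimes>\<^sub>M borel) (\<lambda>(s, v). (s, log_neg (ennreal v)))" by simp
  moreover have "(\<lambda>\<omega>. V (\<lambda>i. X i \<omega>)) \<in> borel_measurable M" "(\<lambda>\<omega>. V (\<lambda>i. X' i \<omega>)) \<in> borel_measurable M'"
    unfolding V_def by measurable
  ultimately show ?thesis
    by (simp add: distr_distr comp_def V(1) log_neg_exp_neg)
qed

section \<open>Existence of a strongest point\<close>

lemma suminf_indicator_eq_top_iff:
  "(\<Sum>i. indicator A (x i) :: ennreal) = \<top> \<longleftrightarrow> infinite {i. x i \<in> A}"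
proof -
  have "(\<Sum>i. indicator A (x i) :: ennreal) = (\<integral>\<^sup>+i. indicator {i. x i \<in> A} i \<partial>count_space UNIV)"
    by (simp add: nn_integral_count_space_nat indicator_def)
  also have "\<dots> = emeasure (count_space UNIV) {i. x i \<in> A}"
    by simp
  finally show ?thesis
    by (cases "finite {i. x i \<in> A}") (simp_all add: emeasure_count_space)
qed

text \<open>Obtained from the test function \<open>y * indicator A\<close>. The next three lemmas
  read it at y = 1, at y = 1 again, and as y tends to 0.\<close>

lemma poisson_laplace_count:
  assumes X: "poisson_laplace M X \<nu>" and A[measurable]: "A \<in> sets \<nu>"
  shows "(\<integral>\<^sup>+\<omega>. exp_neg (y * (\<Sum>i. indicator A (X i \<omega>))) \<partial>M) = exp_neg ((1 - exp_neg y) * emeasure \<nu> A)"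
proof -
  have "(\<integral>\<^sup>+\<omega>. exp_neg (\<Sum>i. y * indicator A (X i \<omega>)) \<partial>M)
     = exp_neg (\<integral>\<^sup>+x. (1 - exp_neg (y * indicator A x)) \<partial>\<nu>)"
    by (rule poisson_laplaceD[OF X]) measurable
  also have "(\<integral>\<^sup>+x. (1 - exp_neg (y * indicator A x)) \<partial>\<nu>) = (\<integral>\<^sup>+x. (1 - exp_neg y) * indicator A x \<partial>\<nu>)"
    by (intro nn_integral_cong) (auto split: split_indicator)
  also have "\<dots> = (1 - exp_neg y) * emeasure \<nu> A"
    by (rule nn_integral_cmult_indicator) fact
  finally show ?thesis by simp
qed

text \<open>The transform of the count at y = 1 is \<open>exp_neg \<top> = 0\<close>, so its
  nonnegative integrand vanishes almost surely, which forces an infinite count.\<close>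

lemma poisson_laplace_AE_infinite:
  assumes X: "poisson_laplace M X \<nu>" and A[measurable]: "A \<in> sets \<nu>" and top: "emeasure \<nu> A = \<top>"
  shows "AE \<omega> in M. infinite {i. X i \<omega> \<in> A}"
proof -
  have [measurable]: "X i \<in> measurable M \<nu>" for i using X by (simp add: poisson_laplace_def)
  have "(\<integral>\<^sup>+\<omega>. exp_neg (1 * (\<Sum>i. indicator A (X i \<omega>))) \<partial>M) = 0"
  proof -
    have "1 - exp_neg 1 \<noteq> 0"
      using exp_neg_eq_1_iff[of 1] antisym[OF exp_neg_le_1[of 1]]
      by (auto simp: diff_eq_0_iff_ennreal simp del: exp_neg_eq_1_iff)
    then show ?thesis
      unfolding poisson_laplace_count[OF X A] by (simp add: top ennreal_mult_eq_top_iff)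
  qed
  then have "AE \<omega> in M. exp_neg (1 * (\<Sum>i. indicator A (X i \<omega>))) = 0"
    by (subst (asm) nn_integral_0_iff_AE) auto
  then show ?thesis
    by eventually_elim (simp add: suminf_indicator_eq_top_iff)
qed

text \<open>The transform at y = 1 attains its largest possible value 1, so the count is almost
  surely 0.\<close>

lemma poisson_laplace_AE_empty:
  assumes X: "poisson_laplace M X \<nu>" and A[measurable]: "A \<in> sets \<nu>" and null: "emeasure \<nu> A = 0"
  shows "AE \<omega> in M. \<forall>i. X i \<omega> \<notin> A"
proof -
  interpret prob_space M using X by (simp add: poisson_laplace_def)
  have [measurable]: "X i \<in> measurable M \<nu>" for i using X by (simp add: poisson_laplace_def)
  let ?N = "\<lambda>\<omega>. \<Sum>i. indicator A (X i \<omega>) :: ennreal"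
  have E: "(\<integral>\<^sup>+\<omega>. exp_neg (1 * ?N \<omega>) \<partial>M) = 1"
    unfolding poisson_laplace_count[OF X A] by (simp add: null)
  have "(\<integral>\<^sup>+\<omega>. (1 - exp_neg (1 * ?N \<omega>)) \<partial>M) = (\<integral>\<^sup>+\<omega>. 1 \<partial>M) - (\<integral>\<^sup>+\<omega>. exp_neg (1 * ?N \<omega>) \<partial>M)"
    by (rule nn_integral_diff) (auto simp: E simp del: mult_1)
  also have "\<dots> = 0" unfolding E by (simp add: emeasure_space_1)
  finally have "AE \<omega> in M. 1 - exp_neg (1 * ?N \<omega>) = 0"
    by (subst (asm) nn_integral_0_iff_AE) auto
  then show ?thesis
  proof eventually_elim
    case (elim \<omega>)
    then have "exp_neg (?N \<omega>) = 1"
      using exp_neg_le_1[of "?N \<omega>"] by (auto simp: diff_eq_0_iff_ennreal intro!: antisym)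
    then have N: "?N \<omega> = 0" by simp
    show ?case
    proof
      fix i
      have "(\<Sum>i\<in>{i}. indicator A (X i \<omega>) :: ennreal) \<le> ?N \<omega>"
        by (rule sum_le_suminf) auto
      then show "X i \<omega> \<notin> A" using N by (auto split: split_indicator_asm)
    qed
  qed
qed

text \<open>For y > 0 the integrand is at most the indicator of a finite count, so the transform
  bounds that probability from below. Along y = 1/(n + 1) the bound tends to 1.\<close>

lemma poisson_laplace_AE_finite:
  assumes X: "poisson_laplace M X \<nu>" and A[measurable]: "A \<in> sets \<nu>" and fin: "emeasure \<nu> A < \<top>"
  shows "AE \<omega> in M. finite {i. X i \<omega> \<in> A}"
proof -
  interpret prob_space M using X by (simp add: poisson_laplace_def)
  have [measurable]: "X i \<in> measurable M \<nu>" for i using X by (simp add: poisson_laplace_def)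
  let ?N = "\<lambda>\<omega>. \<Sum>i. indicator A (X i \<omega>) :: ennreal"
  let ?B = "{\<omega>\<in>space M. ?N \<omega> \<noteq> \<top>}"
  obtain m where m: "emeasure \<nu> A = ennreal m" "0 \<le> m" using fin by (cases "emeasure \<nu> A") auto
  have lower: "exp_neg ((1 - exp_neg (ennreal (1 / real (Suc n)))) * emeasure \<nu> A) \<le> emeasure M ?B" for n
  proof -
    have "(\<integral>\<^sup>+\<omega>. exp_neg (ennreal (1 / real (Suc n)) * ?N \<omega>) \<partial>M) \<le> (\<integral>\<^sup>+\<omega>. indicator ?B \<omega> \<partial>M)"
    proof (intro nn_integral_mono)
      fix \<omega> assume "\<omega> \<in> space M"
      then show "exp_neg (ennreal (1 / real (Suc n)) * ?N \<omega>) \<le> indicator ?B \<omega>"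
        by (cases "?N \<omega> = \<top>") (auto simp: ennreal_mult_top)
    qed
    then show ?thesis unfolding poisson_laplace_count[OF X A] by simp
  qed
  have "(\<lambda>n. exp_neg ((1 - exp_neg (ennreal (1 / real (Suc n)))) * emeasure \<nu> A))
      \<longlonglongrightarrow> exp_neg ((1 - exp_neg (ennreal 0)) * emeasure \<nu> A)"
    using fin LIMSEQ_inverse_real_of_nat unfolding inverse_eq_divide
    by (intro tendsto_exp_neg tendsto_mult_ennreal tendsto_diff_ennreal tendsto_const
        tendsto_ennrealI) auto
  then have "(1::ennreal) \<le> emeasure M ?B"
    using lower by (intro LIMSEQ_le_const2) auto
  then have "emeasure M ?B = 1"
    using emeasure_le_1 by (intro antisym) auto
  then have "AE \<omega> in M. \<omega> \<in> ?B"
    by (intro AE_prob_1) (simp add: emeasure_eq_measure)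
  then show ?thesis
    by eventually_elim (simp add: suminf_indicator_eq_top_iff)
qed

text \<open>
  Let \<open>U\<close> be the union of the rational up-sets of finite intensity and \<open>V\<close> the intersection of those of infinite
  intensity. The sorted process has all its points in \<open>V\<close>, so \<open>V\<close> has infinite intensity; \<open>U\<close> and \<open>V\<close> differ by at
  most one point, so \<open>U\<close> has infinite intensity too and the other process almost surely has a point in \<open>U\<close>,
  above which there are only finitely many.
\<close>

lemma poisson_laplace_max_attained:
  fixes \<nu> :: "ennreal measure"
  assumes X: "poisson_laplace M X \<nu>" and X': "poisson_laplace M' X' \<nu>"
    and sets[measurable_cong]: "sets \<nu> = sets borel"
    and diffuse: "\<And>x. emeasure \<nu> {x} = 0"
    and dec: "AE \<omega> in M'. decseq (\<lambda>i. X' i \<omega>)"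
  shows "AE \<omega> in M. \<exists>j. \<forall>i. X i \<omega> \<le> X j \<omega>"
proof -
  interpret M': prob_space M' using X' by (simp add: poisson_laplace_def)
  \<comment> \<open>Rational thresholds are countable, so almost sure statements about them combine,
    and dense, so they separate points.\<close>
  define C where "C = range (\<lambda>r::rat. ennreal (real_of_rat r))"
  have C: "countable C" by (simp add: C_def)
  define G where "G = {q\<in>C. emeasure \<nu> {q..} < \<top>}"
  have G: "countable G" "countable (C - G)" using C by (auto simp: G_def intro: countable_subset)
  define U where "U = (\<Union>q\<in>G. {q..})"
  define V where "V = (\<Inter>q\<in>C - G. {q..})"
  have U_meas[measurable]: "U \<in> sets \<nu>"
    unfolding U_def sets using G by (intro sets.countable_UN') auto
  have V_meas[measurable]: "V \<in> sets \<nu>"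
  proof (cases "C - G = {}")
    case True
    then have "V = space \<nu>" unfolding V_def True using sets_eq_imp_space_eq[OF sets] by simp
    then show ?thesis by simp
  next
    case False
    then show ?thesis
      unfolding V_def sets using G by (intro sets.countable_INT') auto
  qed
  have "AE \<omega> in M'. \<forall>q\<in>C - G. infinite {i. X' i \<omega> \<in> {q..}}"
    using G by (intro AE_ball_countable' poisson_laplace_AE_infinite[OF X'])
      (auto simp: G_def sets not_less top_unique)
  with dec have inV: "AE \<omega> in M'. infinite {i. X' i \<omega> \<in> V}"
  proof eventually_elim
    case (elim \<omega>)
    \<comment> \<open>Infinitely many indices lie in the up-set of \<open>q\<close>, hence one at or
      beyond i; a decreasing sequence is at least as large at i.\<close>
    have "X' i \<omega> \<ge> q" if q: "q \<in> C - G" for i q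
    proof -
      obtain k where "k \<ge> i" "X' k \<omega> \<in> {q..}"
        using elim(2) q unfolding infinite_nat_iff_unbounded_le by blast
      then show ?thesis
        using decseqD[OF elim(1), of i k] by auto
    qed
    then have "{i. X' i \<omega> \<in> V} = UNIV" by (auto simp: V_def)
    then show ?case by simp
  qed
  have "emeasure \<nu> V = \<top>"
  proof (rule ccontr)
    assume "emeasure \<nu> V \<noteq> \<top>"
    then have "AE \<omega> in M'. finite {i. X' i \<omega> \<in> V}"
      using poisson_laplace_AE_finite[OF X' V_meas] by (simp add: less_top)
    with inV have "AE \<omega> in M'. False" by eventually_elim simp
    then show False by simp
  qed
  obtain z where z: "V \<subseteq> U \<union> {z}"
  proof (cases "V \<subseteq> U")
    case False
    then obtain z where z: "z \<in> V" "z \<notin> U" by auto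
    \<comment> \<open>A rational between x and y has either finite intensity above it, which puts y
      into \<open>U\<close>, or infinite intensity, which keeps x out of \<open>V\<close>.\<close>
    have *: False if "x \<in> V" "y \<in> V" "x \<notin> U" "y \<notin> U" "x < y" for x y
    proof -
      obtain r where r: "x < ennreal (real_of_rat r)" "ennreal (real_of_rat r) < y"
        using ennreal_rat_dense[OF \<open>x < y\<close>] by auto
      let ?q = "ennreal (real_of_rat r)"
      show False
      proof (cases "?q \<in> G")
        case True
        then have "y \<in> U" using less_imp_le[OF r(2)] by (auto simp: U_def)
        then show False using that by simp
      next
        case False
        then have "?q \<in> C - G" by (auto simp: C_def)
        then have "?q \<le> x" using that by (auto simp: V_def)
        then show False using r by simp
      qed
    qed
    have "V \<subseteq> U \<union> {z}"
      using *[of z] *[of _ z] z by (auto, metis linorder_less_linear)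
    then show ?thesis by (rule that)
  qed auto
  have "emeasure \<nu> V \<le> emeasure \<nu> (U \<union> {z})"
    using z U_meas by (intro emeasure_mono sets.Un) (auto simp: sets)
  also have "\<dots> \<le> emeasure \<nu> U + emeasure \<nu> {z}"
    using U_meas by (intro emeasure_subadditive) (auto simp: sets)
  finally have "emeasure \<nu> U = \<top>"
    using \<open>emeasure \<nu> V = \<top>\<close> by (simp add: diffuse top_unique)
  then have "AE \<omega> in M. infinite {i. X i \<omega> \<in> U}"
    by (intro poisson_laplace_AE_infinite[OF X U_meas])
  moreover have "AE \<omega> in M. \<forall>q\<in>G. finite {i. X i \<omega> \<in> {q..}}"
    using G by (intro AE_ball_countable' poisson_laplace_AE_finite[OF X]) (auto simp: G_def sets)
  ultimately show ?thesis
  proof eventually_elim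
    case (elim \<omega>)
    \<comment> \<open>One point in \<open>U\<close> yields a threshold \<open>q\<close> with
      finitely many points at or above it; the largest of these is the largest of all.\<close>
    have "{i. X i \<omega> \<in> U} \<noteq> {}" using elim(1) by (rule infinite_imp_nonempty)
    then obtain k q where k: "q \<in> G" "q \<le> X k \<omega>"
      by (auto simp: U_def)
    let ?I = "{i. X i \<omega> \<in> {q..}}"
    have I: "finite ?I" "k \<in> ?I" using elim k by auto
    then have "Max ((\<lambda>i. X i \<omega>) ` ?I) \<in> (\<lambda>i. X i \<omega>) ` ?I" by (intro Max_in) auto
    then obtain j where j: "j \<in> ?I" "X j \<omega> = Max ((\<lambda>i. X i \<omega>) ` ?I)" by auto
    have "X i \<omega> \<le> X j \<omega>" for i
    proof (cases "i \<in> ?I")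
      case True
      then show ?thesis unfolding j(2) using I by (intro Max_ge) auto
    next
      case False
      then have "X i \<omega> \<le> q" by auto
      also have "q \<le> X j \<omega>" using j by auto
      finally show ?thesis .
    qed
    then show ?case by auto
  qed
qed

section \<open>The carrier-to-interference ratio\<close>

text \<open>Ties do no harm: whichever maximising index is chosen, the term removed from the sum
  equals the supremum. Its finiteness allows the cancellation in \<open>ennreal\<close>.\<close>

lemma CI_ratio_eq_sup_sum:
  assumes max: "\<exists>j. \<forall>i. P i \<le> P j" and fin: "\<And>i. P i < \<top>"
  shows "CI_ratio P = (SUP i. P i) / ((\<Sum>i. P i) - (SUP i. P i))"
proof -
  define j where "j = (SOME j. \<forall>i. P i \<le> P j)"
  have j: "\<forall>i. P i \<le> P j" unfolding j_def using max by (rule someI_ex)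
  then have sup: "(SUP i. P i) = P j" by (intro antisym SUP_least SUP_upper) auto
  have "(\<Sum>i. P i) = (\<Sum>i. (if i = j then P j else 0) + (if i = j then 0 else P i))"
    by (intro suminf_cong) auto
  also have "\<dots> = (\<Sum>i. if i = j then P j else 0) + (\<Sum>i. if i = j then 0 else P i)"
    by (rule suminf_add[symmetric]) auto
  also have "(\<Sum>i. if i = j then P j else 0) = P j"
    by (subst suminf_finite[of "{j}"]) auto
  finally have "(\<Sum>i. P i) - P j = (\<Sum>i. if i = j then 0 else P i)"
    using fin[of j] by simp
  then show ?thesis by (simp add: CI_ratio_def sup j_def[symmetric] Let_def)
qed

text \<open>If no maximum exists, the index chosen by \<^const>\<open>CI_ratio\<close> is the constant
  \<open>SOME j. False\<close>; measurability therefore holds everywhere, not only almost everywhere.\<close>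

lemma measurable_CI_ratio:
  assumes [measurable]: "\<And>i. P i \<in> borel_measurable M" and fin: "\<And>i \<omega>. P i \<omega> < \<top>"
  shows "(\<lambda>\<omega>. CI_ratio (\<lambda>i. P i \<omega>)) \<in> borel_measurable M"
proof -
  define j where "j = (SOME j::nat. False)"
  have "CI_ratio (\<lambda>i. P i \<omega>) = (if \<exists>j. \<forall>i. P i \<omega> \<le> P j \<omega>
      then (SUP i. P i \<omega>) / ((\<Sum>i. P i \<omega>) - (SUP i. P i \<omega>))
      else P j \<omega> / (\<Sum>i. if i = j then 0 else P i \<omega>))" for \<omega>
  proof (cases "\<exists>j. \<forall>i. P i \<omega> \<le> P j \<omega>")
    case True
    then show ?thesis using CI_ratio_eq_sup_sum[OF True fin] by simp
  next
    case False
    then have "(\<lambda>j. \<forall>i. P i \<omega> \<le> P j \<omega>) = (\<lambda>_. False)" by (intro ext) auto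
    then show ?thesis using False by (simp add: CI_ratio_def j_def Let_def)
  qed
  then show ?thesis by simp
qed

text \<open>Both ratios are almost surely the same function of supremum and sum, whose joint law is
  determined by the intensity. For the decreasing sequence the supremum is the term of index 0 and
  the difference is the tail sum.\<close>

lemma distr_CI_ratio_eq:
  fixes \<nu> :: "ennreal measure"
  assumes X: "poisson_laplace M X \<nu>" and X': "poisson_laplace M' X' \<nu>"
    and sets[measurable_cong]: "sets \<nu> = sets borel"
    and diffuse: "\<And>x. emeasure \<nu> {x} = 0"
    and dec: "AE \<omega> in M'. decseq (\<lambda>i. X' i \<omega>)"
    and fin: "\<And>i \<omega>. X i \<omega> < \<top>" "\<And>i \<omega>. X' i \<omega> < \<top>"
  shows "distr M borel (\<lambda>\<omega>. CI_ratio (\<lambda>i. X i \<omega>))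
    = distr M' borel (\<lambda>\<omega>. X' 0 \<omega> / (\<Sum>i. X' (Suc i) \<omega>))"
proof -
  have [measurable]: "X i \<in> borel_measurable M" "X' i \<in> borel_measurable M'" for i
    using X X' by (simp_all add: poisson_laplace_def measurable_cong_sets[OF refl sets])
  note [measurable] = measurable_CI_ratio[OF _ fin(1)]
  let ?F = "\<lambda>(s, z). s / (z - s) :: ennreal"
  have "distr M borel (\<lambda>\<omega>. CI_ratio (\<lambda>i. X i \<omega>)) = distr M borel (\<lambda>\<omega>. ?F (SUP i. X i \<omega>, \<Sum>i. X i \<omega>))"
  proof (rule distr_cong_AE)
    show "AE \<omega> in M. CI_ratio (\<lambda>i. X i \<omega>) = ?F (SUP i. X i \<omega>, \<Sum>i. X i \<omega>)"
      using poisson_laplace_max_attained[OF X X' sets diffuse dec]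
      by eventually_elim (simp add: CI_ratio_eq_sup_sum fin)
  qed auto
  also have "\<dots> = distr (distr M (borel \<Otimes>\<^sub>M borel) (\<lambda>\<omega>. (SUP i. X i \<omega>, \<Sum>i. X i \<omega>))) borel ?F"
    by (subst distr_distr) (auto simp: comp_def)
  also have "\<dots> = distr (distr M' (borel \<Otimes>\<^sub>M borel) (\<lambda>\<omega>. (SUP i. X' i \<omega>, \<Sum>i. X' i \<omega>))) borel ?F"
    by (simp only: poisson_laplace_sup_sum[OF X X' sets])
  also have "\<dots> = distr M' borel (\<lambda>\<omega>. ?F (SUP i. X' i \<omega>, \<Sum>i. X' i \<omega>))"
    by (subst distr_distr) (auto simp: comp_def)
  also have "\<dots> = distr M' borel (\<lambda>\<omega>. X' 0 \<omega> / (\<Sum>i. X' (Suc i) \<omega>))"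
  proof (rule distr_cong_AE)
    show "AE \<omega> in M'. ?F (SUP i. X' i \<omega>, \<Sum>i. X' i \<omega>) = X' 0 \<omega> / (\<Sum>i. X' (Suc i) \<omega>)"
      using dec
    proof eventually_elim
      case (elim \<omega>)
      have "(SUP i. X' i \<omega>) = X' 0 \<omega>"
        using decseqD[OF elim, of 0] by (intro antisym SUP_least SUP_upper) auto
      moreover have "(\<Sum>i. X' i \<omega>) = (\<Sum>i. X' (Suc i) \<omega>) + X' 0 \<omega>"
        using suminf_offset[of "\<lambda>i. X' i \<omega>" 1] by simp
      ultimately show ?case using fin(2)[of 0 \<omega>] by simp
    qed
  qed auto
  finally show ?thesis .
qed

section \<open>Intensity of the received powers\<close>

text \<open>Fubini puts the mark outermost, so the scaling of r by \<open>c x\<close> is done with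
  the mark fixed: it removes the mark from the power and leaves the Jacobian \<open>c x\<close>.
  Averaging over \<open>D\<close> after a second exchange produces \<open>lambar\<close>.\<close>

lemma received_power_intensity:
  fixes eps :: real and lam :: "real \<Rightarrow> real" and D :: "(real \<times> real) measure"
  assumes eps: "eps > 0"
    and lam[measurable]: "lam \<in> borel_measurable borel"
    and lam_nonneg: "\<forall>r\<ge>0. lam r \<ge> 0"
    and D_prob: "prob_space D"
    and D_sets[measurable_cong]: "sets D = sets (borel \<Otimes>\<^sub>M borel)"
    and D_pos: "AE x in D. fst x > 0 \<and> snd x > 0"
    and conv: "\<forall>r\<ge>0. integrable D (\<lambda>x. (fst x * snd x) powr (1/eps) * lam (r * (fst x * snd x) powr (1/eps)))"
  shows "distr (density lborel (\<lambda>r. indicator {0..} r * ennreal (lam r)) \<Otimes>\<^sub>M D) borel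
      (\<lambda>p. ennreal (snd (snd p) * fst (snd p) * fst p powr (- eps)))
    = distr (density lborel (\<lambda>r. indicator {0..} r * ennreal (lambar eps D lam r))) borel
      (\<lambda>r. ennreal (r powr (- eps)))"
    (is "distr (?\<mu> \<Otimes>\<^sub>M D) borel ?g = distr ?\<mu>' borel ?g'")
proof (rule measure_eqI)
  interpret D: prob_space D by fact
  interpret pair_sigma_finite lborel D ..
  define c where "c x = (fst x * snd x) powr (1 / eps)" for x :: "real \<times> real"
  have c[measurable]: "c \<in> borel_measurable D" unfolding c_def by measurable
  have lambar[measurable]: "lambar eps D lam \<in> borel_measurable borel"
    unfolding lambar_def[abs_def] by measurable
  \<comment> \<open>Here convergence of the defining expectation enters: it identifies the Bochner
    integral in \<open>lambar\<close> with the nonnegative one.\<close>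
  have lambar_nn: "ennreal (lambar eps D lam s) = (\<integral>\<^sup>+x. ennreal (c x * lam (s * c x)) \<partial>D)" if "s \<ge> 0" for s
    unfolding lambar_def c_def using conv lam_nonneg that
    by (intro nn_integral_eq_integral[symmetric]) auto
  fix B assume "B \<in> sets (distr (?\<mu> \<Otimes>\<^sub>M D) borel ?g)"
  then have B[measurable]: "B \<in> sets borel" by simp
  have gm[measurable]: "?g \<in> borel_measurable (?\<mu> \<Otimes>\<^sub>M D)" by measurable
  have "emeasure (distr (?\<mu> \<Otimes>\<^sub>M D) borel ?g) B = (\<integral>\<^sup>+p. indicator B (?g p) \<partial>(?\<mu> \<Otimes>\<^sub>M D))"
    by (subst nn_integral_indicator[symmetric], simp, subst nn_integral_distr) auto
  also have "\<dots> = (\<integral>\<^sup>+r. \<integral>\<^sup>+x. indicator B (?g (r, x)) \<partial>D \<partial>?\<mu>)"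
    by (rule D.nn_integral_fst[symmetric]) measurable
  also have "\<dots> = (\<integral>\<^sup>+r. indicator {0..} r * ennreal (lam r) * (\<integral>\<^sup>+x. indicator B (?g (r, x)) \<partial>D) \<partial>lborel)"
    by (rule nn_integral_density) measurable
  also have "\<dots> = (\<integral>\<^sup>+r. \<integral>\<^sup>+x. indicator {0..} r * ennreal (lam r) * indicator B (?g (r, x)) \<partial>D \<partial>lborel)"
    by (intro nn_integral_cong nn_integral_cmult[symmetric]) measurable
  also have "\<dots> = (\<integral>\<^sup>+x. \<integral>\<^sup>+r. indicator {0..} r * ennreal (lam r) * indicator B (?g (r, x)) \<partial>lborel \<partial>D)"
    by (rule Fubini'[symmetric]) measurable
  also have "\<dots> = (\<integral>\<^sup>+x. \<integral>\<^sup>+s. indicator {0..} s * indicator B (?g' s) * ennreal (c x * lam (s * c x)) \<partial>lborel \<partial>D)"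
  proof (intro nn_integral_cong_AE)
    show "AE x in D. (\<integral>\<^sup>+r. indicator {0..} r * ennreal (lam r) * indicator B (?g (r, x)) \<partial>lborel)
      = (\<integral>\<^sup>+s. indicator {0..} s * indicator B (?g' s) * ennreal (c x * lam (s * c x)) \<partial>lborel)"
      using D_pos
    proof eventually_elim
      case (elim x)
      then have cx: "0 < c x" by (auto simp: c_def)
      \<comment> \<open>The scale factor is chosen so that its power \<open>- eps\<close> cancels
        the product of fading and transmission power.\<close>
      have "c x powr (- eps) = (fst x * snd x) powr - 1"
        using eps by (simp add: c_def powr_powr)
      then have c_eps: "snd x * fst x * c x powr (- eps) = 1"
        using elim by (simp add: powr_minus_divide mult.commute)
      have "(\<integral>\<^sup>+r. indicator {0..} r * ennreal (lam r) * indicator B (?g (r, x)) \<partial>lborel)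
        = ennreal \<bar>c x\<bar> * (\<integral>\<^sup>+s. indicator {0..} (0 + c x * s) * ennreal (lam (0 + c x * s))
            * indicator B (?g (0 + c x * s, x)) \<partial>lborel)"
        using cx by (intro nn_integral_real_affine) auto
      also have "\<dots> = (\<integral>\<^sup>+s. ennreal (c x) * (indicator {0..} (c x * s) * ennreal (lam (c x * s))
            * indicator B (?g (c x * s, x))) \<partial>lborel)"
        using cx by (subst nn_integral_cmult) auto
      also have "\<dots> = (\<integral>\<^sup>+s. indicator {0..} s * indicator B (?g' s) * ennreal (c x * lam (s * c x)) \<partial>lborel)"
      proof (intro nn_integral_cong)
        fix s :: real
        show "ennreal (c x) * (indicator {0..} (c x * s) * ennreal (lam (c x * s)) * indicator B (?g (c x * s, x)))
          = indicator {0..} s * indicator B (?g' s) * ennreal (c x * lam (s * c x))"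
        proof (cases "s \<ge> 0")
          case True
          have "snd x * fst x * (c x * s) powr (- eps) = (snd x * fst x * c x powr (- eps)) * s powr (- eps)"
            using True cx by (simp add: powr_mult)
          then have "?g (c x * s, x) = ?g' s" by (simp add: c_eps)
          then show ?thesis
            using True cx lam_nonneg by (simp add: ennreal_mult ac_simps)
        next
          case False
          then show ?thesis using cx by (simp add: zero_le_mult_iff)
        qed
      qed
      finally show ?case .
    qed
  qed
  also have "\<dots> = (\<integral>\<^sup>+s. \<integral>\<^sup>+x. indicator {0..} s * indicator B (?g' s) * ennreal (c x * lam (s * c x)) \<partial>D \<partial>lborel)"
    by (rule Fubini') measurable
  also have "\<dots> = (\<integral>\<^sup>+s. indicator {0..} s * indicator B (?g' s) * (\<integral>\<^sup>+x. ennreal (c x * lam (s * c x)) \<partial>D) \<partial>lborel)"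
    by (intro nn_integral_cong nn_integral_cmult) measurable
  also have "\<dots> = (\<integral>\<^sup>+s. (indicator {0..} s * ennreal (lambar eps D lam s)) * indicator B (?g' s) \<partial>lborel)"
    by (intro nn_integral_cong) (auto simp: lambar_nn mult.commute split: split_indicator)
  also have "\<dots> = (\<integral>\<^sup>+s. indicator B (?g' s) \<partial>?\<mu>')"
    by (rule nn_integral_density[symmetric]) measurable
  also have "\<dots> = emeasure (distr ?\<mu>' borel ?g') B"
    by (subst nn_integral_indicator[symmetric], simp, subst nn_integral_distr) auto
  finally show "emeasure (distr (?\<mu> \<Otimes>\<^sub>M D) borel ?g) B = emeasure (distr ?\<mu>' borel ?g') B" .
qed simp

text \<open>The path loss is injective on the nonnegative reals, so each fibre there has at most one
  point and is Lebesgue null.\<close>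

lemma received_power_diffuse:
  assumes eps: "eps > 0" and [measurable]: "w \<in> borel_measurable borel"
  shows "emeasure (distr (density lborel (\<lambda>r. indicator {0..} r * w r)) borel
    (\<lambda>r::real. ennreal (r powr (- eps)))) {x} = 0"
proof -
  define A where "A = {r::real. 0 \<le> r \<and> ennreal (r powr (- eps)) = x}"
  have "\<exists>a. A \<subseteq> {a}"
  proof -
    have "r = s" if "r \<in> A" "s \<in> A" for r s
    proof -
      have rs: "r powr (- eps) = s powr (- eps)" "0 \<le> r" "0 \<le> s"
        using that by (auto simp: A_def)
      \<comment> \<open>This inversion also holds at t = 0, because \<open>0 powr a = 0\<close> in
        HOL.\<close>
      have "(t powr (- eps)) powr (- 1 / eps) = t" if "0 \<le> t" for t
        using eps that by (simp add: powr_powr)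
      then show ?thesis using rs by metis
    qed
    then show ?thesis by blast
  qed
  then obtain a where a: "A \<subseteq> {a}" ..
  have "emeasure (distr (density lborel (\<lambda>r. indicator {0..} r * w r)) borel
      (\<lambda>r::real. ennreal (r powr (- eps)))) {x}
    = (\<integral>\<^sup>+r. indicator {0..} r * w r * indicator {x} (ennreal (r powr (- eps))) \<partial>lborel)"
    by (subst nn_integral_indicator[symmetric], simp, subst nn_integral_distr)
       (auto simp: nn_integral_density)
  also have "\<dots> = (\<integral>\<^sup>+r. 0 \<partial>(lborel :: real measure))"
    using AE_lborel_singleton[of a] a
    by (intro nn_integral_cong_AE) (auto elim!: eventually_mono simp: A_def split: split_indicator)
  finally show ?thesis by simp
qed

theorem theorem2:
  fixes eps :: real and lam :: "real \<Rightarrow> real" and D :: "(real \<times> real) measure"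
    and M :: "'a measure" and R Psi K :: "nat \<Rightarrow> 'a \<Rightarrow> real"
    and M' :: "'b measure" and Rb :: "nat \<Rightarrow> 'b \<Rightarrow> real"
  assumes eps: "eps > 0"
    and lam_meas: "lam \<in> borel_measurable borel"
    and lam_nonneg: "\<forall>r\<ge>0. lam r \<ge> 0"
    and D_prob: "prob_space D"
    and D_sets: "sets D = sets (borel \<Otimes>\<^sub>M borel)"
    and D_pos: "AE x in D. fst x > 0 \<and> snd x > 0"
    and conv: "\<forall>r\<ge>0. integrable D (\<lambda>x. (fst x * snd x) powr (1/eps) * lam (r * (fst x * snd x) powr (1/eps)))"
    and ppp: "PPP M R lam"
    and marks_meas: "\<forall>i. (\<lambda>\<omega>. (Psi i \<omega>, K i \<omega>)) \<in> M \<rightarrow>\<^sub>M borel \<Otimes>\<^sub>M borel"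
    and marks_law: "\<forall>i. distr M (borel \<Otimes>\<^sub>M borel) (\<lambda>\<omega>. (Psi i \<omega>, K i \<omega>)) = D"
    and marks_indep: "prob_space.indep_vars M (\<lambda>_. borel \<Otimes>\<^sub>M borel) (\<lambda>i \<omega>. (Psi i \<omega>, K i \<omega>)) UNIV"
    and marks_indep_pts: "prob_space.indep_set M
            (sets (vimage_algebra (space M) (\<lambda>\<omega> i. R i \<omega>) (PiM UNIV (\<lambda>_. borel))))
            (sets (vimage_algebra (space M) (\<lambda>\<omega> i. (Psi i \<omega>, K i \<omega>)) (PiM UNIV (\<lambda>_. borel \<Otimes>\<^sub>M borel))))"
    and ppp_bar: "PPP M' Rb (lambar eps D lam)"
    and sorted_bar: "AE \<omega> in M'. incseq (\<lambda>i. Rb i \<omega>)"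
  shows "distr M borel (\<lambda>\<omega>. CI_ratio (\<lambda>i. ennreal (K i \<omega> * Psi i \<omega> * R i \<omega> powr (- eps))))
       = distr M' borel (\<lambda>\<omega>. ennreal (Rb 0 \<omega> powr (- eps))
                              / (\<Sum>i. ennreal (Rb (Suc i) \<omega> powr (- eps))))"
proof -
  interpret M: prob_space M using ppp by (simp add: PPP_def)
  interpret D: prob_space D by fact
  note [measurable] = lam_meas and [measurable_cong] = D_sets
  define \<mu> where "\<mu> = density lborel (\<lambda>r. indicator {0..} r * ennreal (lam r))"
  define \<mu>' where "\<mu>' = density lborel (\<lambda>r. indicator {0..} r * ennreal (lambar eps D lam r))"
  \<comment> \<open>The intensity of the powers in the averaged system; \<open>P\<close> shows that
    the marked system has the same one.\<close>
  define \<nu> where "\<nu> = distr \<mu>' borel (\<lambda>r. ennreal (r powr (- eps)))"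
  have lambar[measurable]: "lambar eps D lam \<in> borel_measurable borel"
    unfolding lambar_def[abs_def] by measurable
  have sets_\<mu>[measurable_cong]: "sets \<mu> = sets borel" by (simp add: \<mu>_def)
  have sets_\<mu>'[measurable_cong]: "sets \<mu>' = sets borel" by (simp add: \<mu>'_def)
  have Rb: "poisson_laplace M' Rb \<mu>'"
    unfolding \<mu>'_def by (rule PPP_imp_poisson_laplace[OF ppp_bar lambar])
  have marked: "poisson_laplace M (\<lambda>i \<omega>. (R i \<omega>, (Psi i \<omega>, K i \<omega>))) (\<mu> \<Otimes>\<^sub>M D)"
  proof (rule poisson_laplace_marking)
    show "poisson_laplace M R \<mu>"
      unfolding \<mu>_def by (rule PPP_imp_poisson_laplace[OF ppp lam_meas])
    show "(\<lambda>\<omega>. (Psi i \<omega>, K i \<omega>)) \<in> measurable M D" for i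
      using marks_meas by (simp add: measurable_cong_sets[OF refl D_sets])
    show "distr M D (\<lambda>\<omega>. (Psi i \<omega>, K i \<omega>)) = D" for i
      using marks_law distr_cong[OF refl D_sets] by (metis (no_types, lifting))
    show "M.indep_vars (\<lambda>_. D) (\<lambda>i \<omega>. (Psi i \<omega>, K i \<omega>)) UNIV"
      using marks_indep unfolding M.indep_vars_def2 by (simp add: measurable_cong_sets[OF refl D_sets] D_sets)
    have "sets (vimage_algebra (space M) (\<lambda>\<omega> i. R i \<omega>) (PiM UNIV (\<lambda>_. \<mu>)))
        = sets (vimage_algebra (space M) (\<lambda>\<omega> i. R i \<omega>) (PiM UNIV (\<lambda>_. borel)))"
      by (intro sets_vimage_algebra_cong sets_PiM_cong refl sets_\<mu>)
    moreover have "sets (vimage_algebra (space M) (\<lambda>\<omega> i. (Psi i \<omega>, K i \<omega>)) (PiM UNIV (\<lambda>_. D)))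
        = sets (vimage_algebra (space M) (\<lambda>\<omega> i. (Psi i \<omega>, K i \<omega>)) (PiM UNIV (\<lambda>_. borel \<Otimes>\<^sub>M borel)))"
      by (intro sets_vimage_algebra_cong sets_PiM_cong refl D_sets)
    ultimately show "M.indep_set
        (sets (vimage_algebra (space M) (\<lambda>\<omega> i. R i \<omega>) (PiM UNIV (\<lambda>_. \<mu>))))
        (sets (vimage_algebra (space M) (\<lambda>\<omega> i. (Psi i \<omega>, K i \<omega>)) (PiM UNIV (\<lambda>_. D))))"
      using marks_indep_pts by simp
  qed fact
  have P: "poisson_laplace M (\<lambda>i \<omega>. ennreal (K i \<omega> * Psi i \<omega> * R i \<omega> powr (- eps))) \<nu>"
  proof -
    have "(\<lambda>p. ennreal (snd (snd p) * fst (snd p) * fst p powr (- eps))) \<in> borel_measurable (\<mu> \<Otimes>\<^sub>M D)"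
      by measurable
    from poisson_laplace_distr[OF marked this] show ?thesis
      unfolding \<nu>_def \<mu>'_def received_power_intensity[OF eps lam_meas lam_nonneg D_prob D_sets D_pos conv, symmetric]
      by (simp add: \<mu>_def)
  qed
  have Q: "poisson_laplace M' (\<lambda>i \<omega>. ennreal (Rb i \<omega> powr (- eps))) \<nu>"
    unfolding \<nu>_def by (rule poisson_laplace_distr[OF Rb]) measurable
  \<comment> \<open>Points at or below 0 must be excluded: since \<open>0 powr (- eps) = 0\<close>,
    a station at the origin would get power 0 and spoil the decreasing order. The intensity gives
    this half-line mass 0.\<close>
  have "emeasure \<mu>' {..0} = (\<integral>\<^sup>+r. indicator {0..} r * ennreal (lambar eps D lam r) * indicator {..0} r \<partial>lborel)"
    unfolding \<mu>'_def by (rule emeasure_density) auto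
  also have "\<dots> = (\<integral>\<^sup>+r. 0 \<partial>(lborel :: real measure))"
    using AE_lborel_singleton[of 0]
    by (intro nn_integral_cong_AE) (auto elim!: eventually_mono split: split_indicator)
  finally have "AE \<omega> in M'. \<forall>i. Rb i \<omega> \<notin> {..0}"
    by (intro poisson_laplace_AE_empty[OF Rb]) (auto simp: sets_\<mu>')
  with sorted_bar have dec: "AE \<omega> in M'. decseq (\<lambda>i. ennreal (Rb i \<omega> powr (- eps)))"
  proof eventually_elim
    case (elim \<omega>)
    then have "ennreal (Rb n \<omega> powr (- eps)) \<le> ennreal (Rb m \<omega> powr (- eps))" if "m \<le> n" for m n
      using that eps incseqD[OF elim(1) that] by (intro ennreal_leI powr_mono2') (auto simp: not_le)
    then show ?case by (simp add: decseq_def)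
  qed
  have diffuse: "emeasure \<nu> {x} = 0" for x
    unfolding \<nu>_def \<mu>'_def using eps by (rule received_power_diffuse) measurable
  show ?thesis
    by (rule distr_CI_ratio_eq[OF P Q _ diffuse dec]) (simp_all add: \<nu>_def)
qed

end
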